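(* Let $M^2\subset\mathbb{I}^3$ be a connected smooth admissible surface in simply isotropic space. Then: (1) The minimal normal $\mathbf{N}_m$ is harmonic, $\Delta\mathbf{N}_m=0$, if and only if $M^2$ has constant isotropic mean curvature. (2) The parabolic normal $\mathbf{G}$ is harmonic, $\Delta\mathbf{G}=0$, if and only if $M^2$ is a piece of a plane.
   Context: Simply isotropic space $\mathbb{I}^3$ is $\mathbb{R}^3$ with the degenerate inner product $\langle X,Y\rangle=x_1y_1+x_2y_2$. A surface $M^2$ with local parametrization $\mathbf{x}(u^1,u^2)$ is admissible if the induced metric $g_{ij}=\langle\mathbf{x}_i,\mathbf{x}_j\rangle$, $\mathbf{x}_i=\partial\mathbf{x}/\partial u^i$, has rank 2; equivalently, the third coordinate $X_{12}$ of the Euclidean cross product $\mathbf{x}_1\times\mathbf{x}_2$ is nowhere zero. Every admissible surface can be locally parametrized in normal form as a graph $\mathbf{x}(u^1,u^2)=(u^1,u^2,f(u^1,u^2))$ with $f$ smooth. The minimal normal is $\mathbf{N}_m=(\mathbf{x}_1\times\mathbf{x}_2)/X_{12}=(N^1,N^2,1)$ and the parabolic normal is $\mathbf{G}=\big(N^1,N^2,\tfrac12-\tfrac12[(N^1)^2+(N^2)^2]\big)$. In normal form, $\mathbf{N}_m=(-f_1,-f_2,1)$ and $\mathbf{G}=\big(-f_1,-f_2,\tfrac12-\tfrac12(f_1^2+f_2^2)\big)$ with $f_i=\partial f/\partial u^i$. The second fundamental form coefficients are $h_{ij}=\mathbf{x}_{ij}\cdot\mathbf{N}_m$ (Euclidean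 dot product, $\mathbf{x}_{ij}=\partial^2\mathbf{x}/\partial u^i\partial u^j$), and the isotropic mean curvature is $H=\frac12\,\frac{g_{11}h_{22}-2g_{12}h_{12}+g_{22}h_{11}}{g_{11}g_{22}-g_{12}^2}$; in normal form $H=\frac12(f_{11}+f_{22})$. $\Delta$ is the Laplace-Beltrami operator of $g_{ij}$, acting coordinatewise on $\mathbb{R}^3$-valued maps; in normal form $\Delta=\partial_1^2+\partial_2^2$. *)

theory Defs
  imports "HOL-Analysis.Analysis"
begin

definition pderiv_at ::
  "2 \<Rightarrow> (real^2 \<Rightarrow> 'b::real_normed_vector) \<Rightarrow> real^2 \<Rightarrow> 'b" where
  "pderiv_at i F u = frechet_derivative F (at u) (axis i 1)"

text \<open>Derivatives are taken in the ambient space, so this is meaningful for open \<open>U\<close> only.\<close>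

primrec Ck_on ::
  "nat \<Rightarrow> ('a::real_normed_vector) set \<Rightarrow> ('a \<Rightarrow> 'b::real_normed_vector) \<Rightarrow> bool" where
  "Ck_on 0 U F \<longleftrightarrow> continuous_on U F"
| "Ck_on (Suc k) U F \<longleftrightarrow>
     (\<forall>u\<in>U. F differentiable (at u)) \<and>
     (\<forall>v. Ck_on k U (\<lambda>u. frechet_derivative F (at u) v))"

definition smooth_on ::
  "('a::real_normed_vector) set \<Rightarrow> ('a \<Rightarrow> 'b::real_normed_vector) \<Rightarrow> bool" where
  "smooth_on U F \<longleftrightarrow> (\<forall>k. Ck_on k U F)"

definition local_parametrization ::
  "(real^3) set \<Rightarrow> (real^2) set \<Rightarrow> (real^2 \<Rightarrow> real^3) \<Rightarrow> bool" where
  "local_parametrization M U x \<longleftrightarrow>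
     open U \<and> smooth_on U x \<and>
     (\<forall>u\<in>U. inj (frechet_derivative x (at u))) \<and>
     openin (top_of_set M) (x ` U) \<and>
     (\<exists>y. homeomorphism U (x ` U) x y)"

definition smooth_surface :: "(real^3) set \<Rightarrow> bool" where
  "smooth_surface M \<longleftrightarrow>
     (\<forall>p\<in>M. \<exists>U x. local_parametrization M U x \<and> p \<in> x ` U)"

definition iso_inner :: "real^3 \<Rightarrow> real^3 \<Rightarrow> real" where
  "iso_inner X Y = X $ 1 * Y $ 1 + X $ 2 * Y $ 2"

text \<open>The definitions below are relative to a parametrization \<open>x\<close>, evaluated at a parameter \<open>u\<close>.\<close>

definition iso_metric :: "(real^2 \<Rightarrow> real^3) \<Rightarrow> real^2 \<Rightarrow> real^2^2" where
  "iso_metric x u = (\<chi> i j. iso_inner (pderiv_at i x u) (pderiv_at j x u))"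

definition admissible_surface :: "(real^3) set \<Rightarrow> bool" where
  "admissible_surface M \<longleftrightarrow>
     smooth_surface M \<and>
     (\<forall>U x. local_parametrization M U x \<longrightarrow> (\<forall>u\<in>U. rank (iso_metric x u) = 2))"

definition minimal_normal :: "(real^2 \<Rightarrow> real^3) \<Rightarrow> real^2 \<Rightarrow> real^3" where
  "minimal_normal x u =
     (let c = cross3 (pderiv_at 1 x u) (pderiv_at 2 x u) in (1 / c $ 3) *\<^sub>R c)"

definition parabolic_normal :: "(real^2 \<Rightarrow> real^3) \<Rightarrow> real^2 \<Rightarrow> real^3" where
  "parabolic_normal x u =
     (let N = minimal_normal x u
      in vector [N $ 1, N $ 2, 1/2 - 1/2 * ((N $ 1)^2 + (N $ 2)^2)])"

definition second_form :: "(real^2 \<Rightarrow> real^3) \<Rightarrow> real^2 \<Rightarrow> real^2^2" where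
  "second_form x u = (\<chi> i j. pderiv_at j (pderiv_at i x) u \<bullet> minimal_normal x u)"

definition iso_mean_curvature :: "(real^2 \<Rightarrow> real^3) \<Rightarrow> real^2 \<Rightarrow> real" where
  "iso_mean_curvature x u =
     (let g = iso_metric x u; h = second_form x u in
      1/2 * ((g$1$1 * h$2$2 - 2 * g$1$2 * h$1$2 + g$2$2 * h$1$1)
             / (g$1$1 * g$2$2 - (g$1$2)^2)))"

definition laplace_beltrami ::
  "(real^2 \<Rightarrow> real^3) \<Rightarrow> (real^2 \<Rightarrow> real) \<Rightarrow> real^2 \<Rightarrow> real" where
  "laplace_beltrami x \<phi> u =
     1 / sqrt (det (iso_metric x u)) *
     (\<Sum>i\<in>UNIV. \<Sum>j\<in>UNIV.
        pderiv_at i (\<lambda>w. sqrt (det (iso_metric x w)) * matrix_inv (iso_metric x w) $ i $ j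
                        * pderiv_at j \<phi> w) u)"

definition vector_laplace_beltrami ::
  "(real^2 \<Rightarrow> real^3) \<Rightarrow> (real^2 \<Rightarrow> real^3) \<Rightarrow> real^2 \<Rightarrow> real^3" where
  "vector_laplace_beltrami x F u = (\<chi> k. laplace_beltrami x (\<lambda>w. F w $ k) u)"

text \<open>\<open>minimal_normal\<close>, \<open>parabolic_normal\<close>, \<open>iso_mean_curvature\<close> and the Laplacian do not change
  under reparametrization (dividing by the third coordinate fixes the sign of the normal), so the
  properties of \<open>M\<close> below are stated in all local parametrizations; in particular the constant in
  \<open>constant_iso_mean_curvature\<close> is the same for all of them.\<close>

definition minimal_normal_harmonic :: "(real^3) set \<Rightarrow> bool" where
  "minimal_normal_harmonic M \<longleftrightarrow>
     (\<forall>U x. local_parametrization M U x \<longrightarrow>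
        (\<forall>u\<in>U. vector_laplace_beltrami x (minimal_normal x) u = 0))"

definition parabolic_normal_harmonic :: "(real^3) set \<Rightarrow> bool" where
  "parabolic_normal_harmonic M \<longleftrightarrow>
     (\<forall>U x. local_parametrization M U x \<longrightarrow>
        (\<forall>u\<in>U. vector_laplace_beltrami x (parabolic_normal x) u = 0))"

definition constant_iso_mean_curvature :: "(real^3) set \<Rightarrow> bool" where
  "constant_iso_mean_curvature M \<longleftrightarrow>
     (\<exists>c. \<forall>U x. local_parametrization M U x \<longrightarrow> (\<forall>u\<in>U. iso_mean_curvature x u = c))"

definition piece_of_plane :: "(real^3) set \<Rightarrow> bool" where
  "piece_of_plane M \<longleftrightarrow>
     (\<exists>P. affine P \<and> aff_dim P = 2 \<and> openin (top_of_set P) M)"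

end

theory Submission
  imports Defs
begin

text \<open>
  Seen from above, an admissible surface is locally a graph, so the first two coordinates
  \<open>p\<close>, \<open>q\<close> of a chart \<open>x = (p, q, r)\<close> are local coordinates on the surface, and in them the
  isotropic metric is the flat metric \<open>dp\<^sup>2 + dq\<^sup>2\<close>. The proof never passes to a graph: on an
  arbitrary chart it uses the operators \<open>D 1\<close>, \<open>D 2\<close> (\<open>top_deriv\<close>), the partial derivatives with
  respect to \<open>p\<close> and \<open>q\<close> written out by Cramer's rule. They are commuting derivations
  (\<open>top_deriv_commute\<close>) and every formula of the normal form survives:
  the Laplacian is \<open>D 1 D 1 + D 2 D 2\<close> (\<open>laplace_beltrami_eq\<close>), the minimal normal is
  \<open>(- D 1 r, - D 2 r, 1)\<close>, and twice the mean curvature \<open>H\<close> is the Laplacian of the height \<open>r\<close>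
  (\<open>iso_mean_curvature_eq\<close>).

  Hence the Laplacian of the \<open>k\<close>-th coordinate of the minimal normal is \<open>- 2 D k H\<close>
  for \<open>k = 1, 2\<close> and \<open>0\<close> for \<open>k = 3\<close>; the minimal normal is harmonic iff \<open>H\<close> is locally constant.
  The parabolic normal shares the first two coordinates; if they are harmonic, the Laplacian
  of the third one, \<open>1/2 - ((D 1 r)\<^sup>2 + (D 2 r)\<^sup>2) / 2\<close>, is minus the sum of the squares of
  all \<open>D i (D k r)\<close>. So it is harmonic iff all these second derivatives vanish, that is, iff the
  slopes \<open>D 1 r\<close>, \<open>D 2 r\<close> are locally constant, which means that the surface is locally planar.

  Passing from "locally constant in a chart" to "constant on \<open>M\<close>" needs \<open>H\<close> and the slopes to be
  functions on the surface. This holds since \<open>D k\<close> does not depend on the chart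
  (\<open>top_deriv_chart_independent\<close>), which in turn rests on the differentiability of transition
  maps: a transition map is a continuous lift of one chart through the other, and a
  continuous lift through an immersion is differentiable (\<open>has_derivative_lift\<close>). Invariance of
  domain finally shows that a surface contained in a plane is open in it.
\<close>

section \<open>Calculus of smooth functions\<close>

lemma Ck_on_cong:
  assumes "open U" and "\<And>u. u \<in> U \<Longrightarrow> F u = G u" and "Ck_on k U F"
  shows "Ck_on k U G"
  using assms(2,3)
proof (induction k arbitrary: F G)
  case 0
  then show ?case by (metis Ck_on.simps(1) continuous_on_cong)
next
  case (Suc k)
  have diff: "F differentiable (at u)" if "u \<in> U" for u
    using Suc.prems that by simp
  have "G differentiable (at u)" if "u \<in> U" for u
    using diff[OF that] Suc.prems(1) that \<open>open U\<close>
    by (meson differentiable_def has_derivative_transform_within_open)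
  moreover have "frechet_derivative F (at u) = frechet_derivative G (at u)" if "u \<in> U" for u
    using frechet_derivative_transform_within_open[OF diff[OF that] \<open>open U\<close> that] Suc.prems(1) by simp
  then have "Ck_on k U (\<lambda>u. frechet_derivative G (at u) v)" for v
    using Suc.IH[of "\<lambda>u. frechet_derivative F (at u) v" "\<lambda>u. frechet_derivative G (at u) v"] Suc.prems
    by simp
  ultimately show ?case by simp
qed

text \<open>Lets any known derivative \<open>F'\<close> stand in for the chosen \<open>frechet_derivative\<close>, so that the closure
  properties below follow from the usual differentiation rules by induction on \<open>k\<close>.\<close>

lemma Ck_on_SucI:
  assumes "open U" and "\<And>u. u \<in> U \<Longrightarrow> (F has_derivative F' u) (at u)"
    and "\<And>v. Ck_on k U (\<lambda>u. F' u v)"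
  shows "Ck_on (Suc k) U F"
proof -
  have "frechet_derivative F (at u) = F' u" if "u \<in> U" for u
    using assms(2)[OF that] by (metis frechet_derivative_at)
  then have "Ck_on k U (\<lambda>u. frechet_derivative F (at u) v)" for v
    using Ck_on_cong[OF assms(1) _ assms(3)[of v]] by simp
  then show ?thesis
    using assms(2) by (auto simp: differentiable_def)
qed

lemma Ck_on_SucD:
  "Ck_on (Suc k) U F \<Longrightarrow> Ck_on k U F"
proof (induction k arbitrary: F)
  case 0
  then show ?case
    by (simp add: continuous_at_imp_continuous_on differentiable_imp_continuous_within)
qed simp

lemma Ck_on_derivative:
  "Ck_on (Suc k) U F \<Longrightarrow> u \<in> U \<Longrightarrow> (F has_derivative frechet_derivative F (at u)) (at u)"
  by (simp add: frechet_derivative_works)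

lemma Ck_on_const: "Ck_on k U (\<lambda>u. c)"
  by (induction k arbitrary: c) auto

lemma Ck_on_linear:
  assumes "open U" "bounded_linear L" "Ck_on k U F"
  shows "Ck_on k U (\<lambda>u. L (F u))"
  using assms(3)
proof (induction k arbitrary: F)
  case 0
  then show ?case using bounded_linear.continuous_on[OF assms(2)] by auto
next
  case (Suc k)
  show ?case
    by (rule Ck_on_SucI[OF \<open>open U\<close> bounded_linear.has_derivative[OF assms(2) Ck_on_derivative[OF Suc.prems]]])
       (use Suc in auto)
qed

lemma Ck_on_add:
  assumes "open U" "Ck_on k U F" "Ck_on k U G"
  shows "Ck_on k U (\<lambda>u. F u + G u)"
  using assms(2,3)
proof (induction k arbitrary: F G)
  case 0
  then show ?case by (auto intro: continuous_intros)
next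
  case (Suc k)
  show ?case
    by (rule Ck_on_SucI[OF \<open>open U\<close> has_derivative_add[OF Ck_on_derivative Ck_on_derivative]])
       (use Suc in auto)
qed

lemma Ck_on_mult:
  fixes F G :: "'a::real_normed_vector \<Rightarrow> real"
  assumes "open U" "Ck_on k U F" "Ck_on k U G"
  shows "Ck_on k U (\<lambda>u. F u * G u)"
  using assms(2,3)
proof (induction k arbitrary: F G)
  case 0
  then show ?case by (auto intro: continuous_intros)
next
  case (Suc k)
  have "Ck_on k U F" "Ck_on k U G"
    using Suc.prems Ck_on_SucD by blast+
  then have "Ck_on k U (\<lambda>u. F u * frechet_derivative G (at u) v + frechet_derivative F (at u) v * G u)" for v
    using Suc.prems by (intro Ck_on_add[OF \<open>open U\<close>] Suc.IH) auto
  moreover have "((\<lambda>u. F u * G u) has_derivative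
      (\<lambda>v. F u * frechet_derivative G (at u) v + frechet_derivative F (at u) v * G u)) (at u)" if "u \<in> U" for u
    using has_derivative_mult[OF Ck_on_derivative[OF Suc.prems(1) that] Ck_on_derivative[OF Suc.prems(2) that]] .
  ultimately show ?case
    by (rule Ck_on_SucI[OF \<open>open U\<close>, rotated])
qed

lemma Ck_on_inverse:
  fixes F :: "'a::real_normed_vector \<Rightarrow> real"
  assumes "open U" "\<And>u. u \<in> U \<Longrightarrow> F u \<noteq> 0" "Ck_on k U F"
  shows "Ck_on k U (\<lambda>u. inverse (F u))"
  using assms(2,3)
proof (induction k arbitrary: F)
  case 0
  then show ?case by (simp add: continuous_on_inverse)
next
  case (Suc k)
  have inv: "Ck_on k U (\<lambda>u. inverse (F u))"
    by (rule Suc.IH[OF Suc.prems(1) Ck_on_SucD[OF Suc.prems(2)]])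
  have "((\<lambda>u. inverse (F u)) has_derivative
      (\<lambda>v. (-1) * (inverse (F u) * frechet_derivative F (at u) v * inverse (F u)))) (at u)" if "u \<in> U" for u
    using Deriv.has_derivative_inverse[OF Suc.prems(1)[OF that] Ck_on_derivative[OF Suc.prems(2) that]] by simp
  moreover have "Ck_on k U (\<lambda>u. (-1) * (inverse (F u) * frechet_derivative F (at u) v * inverse (F u)))" for v
    by (intro Ck_on_mult[OF \<open>open U\<close>] Ck_on_const inv) (use Suc.prems(2) in simp)
  ultimately show ?case
    by (rule Ck_on_SucI[OF \<open>open U\<close>])
qed

named_theorems smooth_intros

lemma smooth_on_cong:
  assumes "open U" "\<And>u. u \<in> U \<Longrightarrow> F u = G u" "smooth_on U F"
  shows "smooth_on U G"
  using Ck_on_cong[OF assms(1,2)] assms(3) unfolding smooth_on_def by simp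

lemma smooth_on_const [smooth_intros]: "smooth_on U (\<lambda>u. c)"
  by (simp add: smooth_on_def Ck_on_const)

lemma smooth_on_linear:
  "open U \<Longrightarrow> bounded_linear L \<Longrightarrow> smooth_on U F \<Longrightarrow> smooth_on U (\<lambda>u. L (F u))"
  by (simp add: smooth_on_def Ck_on_linear)

lemma smooth_on_add [smooth_intros]:
  "open U \<Longrightarrow> smooth_on U F \<Longrightarrow> smooth_on U G \<Longrightarrow> smooth_on U (\<lambda>u. F u + G u)"
  by (simp add: smooth_on_def Ck_on_add)

lemma smooth_on_mult [smooth_intros]:
  fixes F G :: "'a::real_normed_vector \<Rightarrow> real"
  shows "open U \<Longrightarrow> smooth_on U F \<Longrightarrow> smooth_on U G \<Longrightarrow> smooth_on U (\<lambda>u. F u * G u)"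
  by (simp add: smooth_on_def Ck_on_mult)

lemma smooth_on_minus [smooth_intros]:
  "open U \<Longrightarrow> smooth_on U F \<Longrightarrow> smooth_on U (\<lambda>u. - F u)"
  using smooth_on_linear[OF _ bounded_linear_minus[OF bounded_linear_ident]] .

lemma smooth_on_diff [smooth_intros]:
  "open U \<Longrightarrow> smooth_on U F \<Longrightarrow> smooth_on U G \<Longrightarrow> smooth_on U (\<lambda>u. F u - G u)"
  using smooth_on_add[OF _ _ smooth_on_minus, of U F G] by simp

lemma smooth_on_divide [smooth_intros]:
  fixes F G :: "'a::real_normed_vector \<Rightarrow> real"
  shows "open U \<Longrightarrow> smooth_on U F \<Longrightarrow> smooth_on U G \<Longrightarrow> (\<And>u. u \<in> U \<Longrightarrow> G u \<noteq> 0)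
    \<Longrightarrow> smooth_on U (\<lambda>u. F u / G u)"
  unfolding divide_inverse
  by (rule smooth_on_mult) (simp_all add: smooth_on_def Ck_on_inverse)

lemma smooth_on_frechet:
  "smooth_on U F \<Longrightarrow> smooth_on U (\<lambda>u. frechet_derivative F (at u) v)"
  unfolding smooth_on_def by (metis Ck_on.simps(2))

lemma smooth_on_pderiv [smooth_intros]:
  "smooth_on U F \<Longrightarrow> smooth_on U (pderiv_at i F)"
  unfolding pderiv_at_def by (rule smooth_on_frechet)

lemma smooth_on_differentiable:
  "smooth_on U F \<Longrightarrow> u \<in> U \<Longrightarrow> F differentiable (at u)"
  unfolding smooth_on_def by (metis Ck_on.simps(2))

lemma smooth_on_continuous:
  "smooth_on U F \<Longrightarrow> continuous_on U F"
  unfolding smooth_on_def by (metis Ck_on.simps(1))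

lemma smooth_on_subset:
  assumes "smooth_on U F" "V \<subseteq> U"
  shows "smooth_on V F"
proof -
  have "Ck_on k U F \<Longrightarrow> Ck_on k V F" for k
  proof (induction k arbitrary: F)
    case 0 then show ?case using assms(2) continuous_on_subset by auto
  next
    case (Suc k) then show ?case using assms(2) by auto
  qed
  then show ?thesis using assms(1) by (simp add: smooth_on_def)
qed

section \<open>Symmetry of second derivatives\<close>

text \<open>Two applications of the mean value theorem, first in the direction \<open>v\<close> and then in the direction
  \<open>w\<close>. The left-hand side is symmetric in \<open>v\<close> and \<open>w\<close> while the right-hand side is not; this is the
  source of the symmetry of second derivatives.\<close>

lemma second_difference:
  fixes F :: "'a::real_normed_vector \<Rightarrow> real"
  assumes "smooth_on U F" "0 < h"
    and inU: "\<And>s t. s \<in> {0..h} \<Longrightarrow> t \<in> {0..h} \<Longrightarrow> u + s *\<^sub>R v + t *\<^sub>R w \<in> U"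
  obtains s t where "0 < s" "s < h" "0 < t" "t < h"
    "F (u + h *\<^sub>R v + h *\<^sub>R w) - F (u + h *\<^sub>R v) - F (u + h *\<^sub>R w) + F u =
     frechet_derivative (\<lambda>y. frechet_derivative F (at y) v) (at (u + s *\<^sub>R v + t *\<^sub>R w)) w * h * h"
proof -
  have along: "((\<lambda>s. G (c + s *\<^sub>R d)) has_derivative (\<lambda>y. frechet_derivative G (at (c + s *\<^sub>R d)) d * y)) (at s)"
    if G: "smooth_on U G" and c: "c + s *\<^sub>R d \<in> U" for G :: "'a \<Rightarrow> real" and c d s
  proof -
    let ?G' = "frechet_derivative G (at (c + s *\<^sub>R d))"
    have G': "(G has_derivative ?G') (at (c + s *\<^sub>R d))"
      using smooth_on_differentiable[OF that] by (simp add: frechet_derivative_works)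
    have "((\<lambda>s. c + s *\<^sub>R d) has_derivative (\<lambda>y. y *\<^sub>R d)) (at s)"
      by (auto intro!: derivative_eq_intros)
    from has_derivative_compose[OF this G']
    have "((\<lambda>s. G (c + s *\<^sub>R d)) has_derivative (\<lambda>y. ?G' (y *\<^sub>R d))) (at s)" .
    moreover have "?G' (y *\<^sub>R d) = ?G' d * y" for y
      using linear_cmul[OF has_derivative_linear[OF G']] by simp
    ultimately show ?thesis by simp
  qed
  let ?F' = "\<lambda>y. frechet_derivative F (at y) v"
  \<comment> \<open>The increment by \<open>h *\<^sub>R w\<close> as a function of the displacement along \<open>v\<close>.\<close>
  let ?\<phi> = "\<lambda>s. F ((u + h *\<^sub>R w) + s *\<^sub>R v) - F (u + s *\<^sub>R v)"
  have in1: "(u + h *\<^sub>R w) + s *\<^sub>R v \<in> U" and in2: "u + s *\<^sub>R v \<in> U" if "s \<in> {0..h}" for s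
    using inU[OF that, of h] inU[OF that, of 0] \<open>0 < h\<close> by (auto simp: algebra_simps)
  have \<phi>': "(?\<phi> has_derivative (\<lambda>y. (?F' ((u + h *\<^sub>R w) + s *\<^sub>R v) - ?F' (u + s *\<^sub>R v)) * y)) (at s)"
    if "s \<in> {0..h}" for s
    using has_derivative_diff[OF along[OF assms(1) in1[OF that]] along[OF assms(1) in2[OF that]]]
    by (simp add: algebra_simps)
  let ?\<phi>' = "\<lambda>s y. (?F' ((u + h *\<^sub>R w) + s *\<^sub>R v) - ?F' (u + s *\<^sub>R v)) * y"
  obtain s where s: "0 < s" "s < h"
    "?\<phi> h - ?\<phi> 0 = (?F' ((u + h *\<^sub>R w) + s *\<^sub>R v) - ?F' (u + s *\<^sub>R v)) * (h - 0)"
  proof (rule mvt[OF \<open>0 < h\<close>, of ?\<phi> ?\<phi>'])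
    show "continuous_on {0..h} ?\<phi>"
      by (intro continuous_at_imp_continuous_on ballI has_derivative_continuous[OF \<phi>'])
  next
    fix s assume "0 < s" "s < h"
    then show "(?\<phi> has_derivative ?\<phi>' s) (at s)" by (intro \<phi>') auto
  qed
  let ?\<chi> = "\<lambda>t. ?F' ((u + s *\<^sub>R v) + t *\<^sub>R w)"
  have \<chi>': "(?\<chi> has_derivative (\<lambda>y. frechet_derivative ?F' (at ((u + s *\<^sub>R v) + t *\<^sub>R w)) w * y)) (at t)"
    if "t \<in> {0..h}" for t
    using along[OF smooth_on_frechet[OF assms(1)] inU[OF _ that]] s by auto
  let ?\<chi>' = "\<lambda>t y. frechet_derivative ?F' (at ((u + s *\<^sub>R v) + t *\<^sub>R w)) w * y"
  obtain t where t: "0 < t" "t < h"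
    "?\<chi> h - ?\<chi> 0 = frechet_derivative ?F' (at ((u + s *\<^sub>R v) + t *\<^sub>R w)) w * (h - 0)"
  proof (rule mvt[OF \<open>0 < h\<close>, of ?\<chi> ?\<chi>'])
    show "continuous_on {0..h} ?\<chi>"
      by (intro continuous_at_imp_continuous_on ballI has_derivative_continuous[OF \<chi>'])
  next
    fix t assume "0 < t" "t < h"
    then show "(?\<chi> has_derivative ?\<chi>' t) (at t)" by (intro \<chi>') auto
  qed
  show thesis
  proof (rule that[OF s(1,2) t(1,2)])
    have "F (u + h *\<^sub>R v + h *\<^sub>R w) - F (u + h *\<^sub>R v) - F (u + h *\<^sub>R w) + F u = ?\<phi> h - ?\<phi> 0"
      by (simp add: algebra_simps)
    also have "\<dots> = (?\<chi> h - ?\<chi> 0) * h"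
      using s(3) by (simp add: algebra_simps)
    also have "\<dots> = frechet_derivative ?F' (at (u + s *\<^sub>R v + t *\<^sub>R w)) w * h * h"
      using t(3) by simp
    finally show "F (u + h *\<^sub>R v + h *\<^sub>R w) - F (u + h *\<^sub>R v) - F (u + h *\<^sub>R w) + F u = \<dots>" .
  qed
qed

text \<open>Both mixed derivatives, taken at suitable points near \<open>u\<close>, equal the same second difference divided by
  \<open>h\<^sup>2\<close>; by continuity they differ by less than any \<open>2 * e\<close> at \<open>u\<close> itself.\<close>

lemma frechet_derivative_commute:
  fixes F :: "'a::real_normed_vector \<Rightarrow> real"
  assumes "open U" "smooth_on U F" "u \<in> U"
  shows "frechet_derivative (\<lambda>y. frechet_derivative F (at y) v) (at u) w
       = frechet_derivative (\<lambda>y. frechet_derivative F (at y) w) (at u) v"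
    (is "?A u = ?B u")
proof -
  have cont: "isCont ?A u" "isCont ?B u"
    using smooth_on_continuous[OF smooth_on_frechet[OF smooth_on_frechet[OF assms(2)]]] assms(1,3)
      continuous_on_eq_continuous_at by blast+
  have "\<bar>?A u - ?B u\<bar> < 2 * e" if "e > 0" for e
  proof -
    obtain d1 where d1: "d1 > 0" "\<And>y. dist y u < d1 \<Longrightarrow> dist (?A y) (?A u) < e"
      using cont(1) \<open>e > 0\<close> unfolding continuous_at_eps_delta by blast
    obtain d2 where d2: "d2 > 0" "\<And>y. dist y u < d2 \<Longrightarrow> dist (?B y) (?B u) < e"
      using cont(2) \<open>e > 0\<close> unfolding continuous_at_eps_delta by blast
    obtain d3 where d3: "d3 > 0" "\<And>y. dist y u < d3 \<Longrightarrow> y \<in> U"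
      using assms(1,3) by (metis open_dist)
    \<comment> \<open>The step \<open>h\<close> is so small that the parallelogram spanned by \<open>h *\<^sub>R v\<close> and \<open>h *\<^sub>R w\<close> at \<open>u\<close>
      has all its points at distance less than \<open>d\<close> from \<open>u\<close>.\<close>
    define d where "d = min d1 (min d2 d3)"
    define h where "h = d / (norm v + norm w + 1)"
    have "d > 0" using d1 d2 d3 by (simp add: d_def)
    then have "h > 0"
      unfolding h_def by (intro divide_pos_pos) (auto intro: add_nonneg_pos)
    have near: "dist (u + s *\<^sub>R v + t *\<^sub>R w) u < d" if "s \<in> {0..h}" "t \<in> {0..h}" for s t
    proof -
      have "dist (u + s *\<^sub>R v + t *\<^sub>R w) u \<le> s * norm v + t * norm w"
        using that norm_triangle_ineq[of "s *\<^sub>R v" "t *\<^sub>R w"] by (simp add: dist_norm add.assoc)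
      also have "\<dots> \<le> h * norm v + h * norm w"
        using that by (intro add_mono mult_right_mono) auto
      also have "\<dots> < h * (norm v + norm w + 1)"
        using \<open>h > 0\<close> by (simp add: algebra_simps)
      also have "\<dots> = d"
        using norm_ge_zero[of v] norm_ge_zero[of w] unfolding h_def by (simp del: norm_ge_zero)
      finally show ?thesis .
    qed
    have inU: "u + s *\<^sub>R v + t *\<^sub>R w \<in> U" if "s \<in> {0..h}" "t \<in> {0..h}" for s t
      using d3(2) near[OF that] by (simp add: d_def)
    have inU': "u + s *\<^sub>R w + t *\<^sub>R v \<in> U" if "s \<in> {0..h}" "t \<in> {0..h}" for s t
      using inU[OF that(2,1)] by (simp add: algebra_simps)
    obtain s t where st: "0 < s" "s < h" "0 < t" "t < h"
      "F (u + h *\<^sub>R v + h *\<^sub>R w) - F (u + h *\<^sub>R v) - F (u + h *\<^sub>R w) + F u =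
       ?A (u + s *\<^sub>R v + t *\<^sub>R w) * h * h"
      using second_difference[OF assms(2) \<open>h > 0\<close> inU] by blast
    obtain s' t' where st': "0 < s'" "s' < h" "0 < t'" "t' < h"
      "F (u + h *\<^sub>R w + h *\<^sub>R v) - F (u + h *\<^sub>R w) - F (u + h *\<^sub>R v) + F u =
       ?B (u + s' *\<^sub>R w + t' *\<^sub>R v) * h * h"
      using second_difference[OF assms(2) \<open>h > 0\<close> inU'] by blast
    have "?A (u + s *\<^sub>R v + t *\<^sub>R w) * (h * h) = ?B (u + t' *\<^sub>R v + s' *\<^sub>R w) * (h * h)"
      using st(5) st'(5) by (simp add: algebra_simps)
    then have "?A (u + s *\<^sub>R v + t *\<^sub>R w) = ?B (u + t' *\<^sub>R v + s' *\<^sub>R w)"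
      using \<open>h > 0\<close> by simp
    moreover have "dist (?A (u + s *\<^sub>R v + t *\<^sub>R w)) (?A u) < e"
      using d1(2) near[of s t] st by (simp add: d_def)
    moreover have "dist (?B (u + t' *\<^sub>R v + s' *\<^sub>R w)) (?B u) < e"
      using d2(2) near[of t' s'] st' by (simp add: d_def)
    ultimately show ?thesis by (simp add: dist_real_def)
  qed
  from this[of "\<bar>?A u - ?B u\<bar> / 2"] show ?thesis by (cases "?A u = ?B u") auto
qed

lemma pderiv_commute:
  fixes F :: "real^2 \<Rightarrow> real"
  assumes "open U" "smooth_on U F" "u \<in> U"
  shows "pderiv_at i (pderiv_at j F) u = pderiv_at j (pderiv_at i F) u"
  unfolding pderiv_at_def using frechet_derivative_commute[OF assms] by blast

section \<open>Lifting through an immersion\<close>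

text \<open>An inverse function theorem for a map \<open>g\<close> already known to be continuous, where \<open>f\<close> may
  raise the dimension. With a left inverse \<open>L\<close> of \<open>f'\<close>, the derivative of \<open>g\<close> must be
  \<open>L \<circ> h'\<close>, as
  \<open>g y - g a = L ((h y - h a) - (f (g y) - f (g a) - f' (g y - g a)))\<close>. The remainder of \<open>f\<close> is small
  relative to \<open>g y - g a\<close>; to compare it with \<open>y - a\<close>, the same identity is first used to show
  that \<open>g\<close> is Lipschitz at \<open>a\<close>.\<close>

lemma has_derivative_lift:
  fixes f :: "'b::euclidean_space \<Rightarrow> 'c::euclidean_space" and h :: "'a::real_normed_vector \<Rightarrow> 'c"
  assumes f: "(f has_derivative f') (at (g a))" and inj: "inj f'"
    and h: "(h has_derivative h') (at a)"
    and g: "isCont g a" and eq: "\<forall>\<^sub>F y in at a. f (g y) = h y" and eqa: "f (g a) = h a"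
  shows "g differentiable (at a)"
proof -
  obtain L where L: "linear L" "L \<circ> f' = id"
    using linear_injective_left_inverse[OF has_derivative_linear[OF f] inj] by blast
  then interpret L: bounded_linear L by (simp add: linear_conv_bounded_linear)
  interpret f': bounded_linear f' using f by (rule has_derivative_bounded_linear)
  interpret h': bounded_linear h' using h by (rule has_derivative_bounded_linear)
  have Lf: "L (f' v) = v" for v using L(2) by (metis comp_apply id_apply)
  obtain C where C: "C > 0" "\<And>v. norm (L v) \<le> norm v * C" using L.pos_bounded by blast
  obtain K where K: "K > 0" "\<And>v. norm (h' v) \<le> norm v * K" using h'.pos_bounded by blast
  have small_f: "\<forall>\<^sub>F y in at a. norm (f (g y) - f (g a) - f' (g y - g a)) \<le> e * norm (g y - g a)"
    if "e > 0" for e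
  proof -
    obtain d where d: "d > 0" "\<And>z. norm (z - g a) < d \<Longrightarrow> norm (f z - f (g a) - f' (z - g a)) \<le> e * norm (z - g a)"
      using f[unfolded has_derivative_at_alt, THEN conjunct2, rule_format, OF \<open>e > 0\<close>] by blast
    have "\<forall>\<^sub>F y in at a. dist (g y) (g a) < d"
      using g d(1) unfolding isCont_def tendsto_iff by blast
    then show ?thesis by eventually_elim (use d(2) in \<open>simp add: dist_norm\<close>)
  qed
  have small_h: "\<forall>\<^sub>F y in at a. norm (h y - h a - h' (y - a)) \<le> e * norm (y - a)"
    if "e > 0" for e
    using h[unfolded has_derivative_at_alt, THEN conjunct2, rule_format, OF \<open>e > 0\<close>]
    unfolding eventually_at dist_norm by blast
  have half: "0 < 1 / (2 * C)" using C(1) by simp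
  \<comment> \<open>With the factor \<open>1 / (2 * C)\<close> the remainder of \<open>f\<close> contributes at most half of
    \<open>norm (g y - g a)\<close>, which is absorbed on the left.\<close>
  have lip: "\<forall>\<^sub>F y in at a. norm (g y - g a) \<le> 2 * C * (1 + K) * norm (y - a)"
    using small_f[OF half] small_h[OF zero_less_one] eq
  proof eventually_elim
    case (elim y)
    let ?r = "f (g y) - f (g a) - f' (g y - g a)"
    have "norm (h y - h a) \<le> norm (h y - h a - h' (y - a)) + norm (h' (y - a))"
      by (metis diff_add_cancel norm_triangle_ineq)
    then have hy: "norm (h y - h a) \<le> (1 + K) * norm (y - a)"
      using elim K(2)[of "y - a"] by (simp add: algebra_simps)
    have "g y - g a = L ((h y - h a) - ?r)"
      using elim eqa by (simp add: Lf)
    then have "norm (g y - g a) \<le> norm ((h y - h a) - ?r) * C" using C(2) by metis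
    also have "\<dots> \<le> (norm (h y - h a) + norm ?r) * C"
      using C(1) norm_triangle_ineq4 by (intro mult_right_mono) auto
    also have "\<dots> \<le> ((1 + K) * norm (y - a) + 1 / (2 * C) * norm (g y - g a)) * C"
      using hy elim C(1) by (intro mult_right_mono add_mono) auto
    also have "\<dots> = C * (1 + K) * norm (y - a) + norm (g y - g a) / 2"
      using C(1) by (simp add: field_simps)
    finally show ?case by simp
  qed
  have "(g has_derivative (\<lambda>v. L (h' v))) (at a)"
    unfolding has_derivative_at_alt
  proof (intro conjI allI impI)
    show "bounded_linear (\<lambda>v. L (h' v))"
      by (rule bounded_linear_compose) (rule L.bounded_linear_axioms h'.bounded_linear_axioms)+
    fix e :: real assume "e > 0"
    \<comment> \<open>Chosen so that the remainders of \<open>h\<close> and of \<open>f\<close> each contribute \<open>e / 2\<close>.\<close>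
    define e1 where "e1 = e / (2 * C)"
    define e2 where "e2 = e / (4 * C * C * (1 + K))"
    have e12: "e1 > 0" "e2 > 0" using \<open>e > 0\<close> C K by (auto simp: e1_def e2_def)
    have "\<forall>\<^sub>F y in at a. norm (g y - g a - L (h' (y - a))) \<le> e * norm (y - a)"
      using small_f[OF e12(2)] small_h[OF e12(1)] eq lip
    proof eventually_elim
      case (elim y)
      let ?r = "f (g y) - f (g a) - f' (g y - g a)" and ?s = "h y - h a - h' (y - a)"
      have "g y - g a - L (h' (y - a)) = L (?s - ?r)"
        using elim eqa by (simp add: L.diff Lf)
      then have "norm (g y - g a - L (h' (y - a))) \<le> norm (?s - ?r) * C" using C(2) by metis
      also have "\<dots> \<le> (norm ?s + norm ?r) * C"
        using C(1) norm_triangle_ineq4 by (intro mult_right_mono) auto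
      also have "\<dots> \<le> (e1 * norm (y - a) + e2 * (2 * C * (1 + K) * norm (y - a))) * C"
      proof (intro mult_right_mono add_mono)
        show "norm ?r \<le> e2 * (2 * C * (1 + K) * norm (y - a))"
          using elim(1) mult_left_mono[OF elim(4), of e2] e12 by linarith
      qed (use elim C in auto)
      also have "\<dots> = e * norm (y - a)"
      proof -
        have "e1 * C = e / 2" "e2 * (2 * C * (1 + K)) * C = e / 2"
          using C(1) K(1) by (auto simp: e1_def e2_def field_simps add_nonneg_eq_0_iff)
        moreover have "(e1 * n + e2 * (2 * C * (1 + K) * n)) * C = (e1 * C + e2 * (2 * C * (1 + K)) * C) * n" for n
          by (simp add: algebra_simps)
        ultimately show ?thesis by simp
      qed
      finally show ?case .
    qed
    then obtain d where "d > 0" and d: "\<And>y. y \<noteq> a \<Longrightarrow> dist y a < d \<Longrightarrow> norm (g y - g a - L (h' (y - a))) \<le> e * norm (y - a)"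
      unfolding eventually_at by blast
    have "norm (g y - g a - L (h' (y - a))) \<le> e * norm (y - a)" if "norm (y - a) < d" for y
      using d[of y] that by (cases "y = a") (auto simp: dist_norm h'.zero L.zero)
    then show "\<exists>d>0. \<forall>y. norm (y - a) < d \<longrightarrow> norm (g y - g a - L (h' (y - a))) \<le> e * norm (y - a)"
      using \<open>d > 0\<close> by blast
  qed
  then show ?thesis by (auto simp: differentiable_def)
qed

section \<open>Partial derivatives\<close>

lemma pderiv_at_eq: "(F has_derivative F') (at u) \<Longrightarrow> pderiv_at i F u = F' (axis i 1)"
  unfolding pderiv_at_def by (metis frechet_derivative_at)

lemma pderiv_at_cong:
  assumes "open U" "u \<in> U" "\<And>w. w \<in> U \<Longrightarrow> F w = G w"
  shows "pderiv_at i F u = pderiv_at i G u"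
proof -
  have "(F has_derivative L) (at u) \<longleftrightarrow> (G has_derivative L) (at u)" for L
    using has_derivative_transform_within_open[OF _ assms(1,2)] assms(3) by metis
  then show ?thesis unfolding pderiv_at_def frechet_derivative_def by simp
qed

lemma has_derivative_pderiv_at:
  fixes F :: "real^2 \<Rightarrow> real"
  assumes "F differentiable (at u)"
  shows "(F has_derivative (\<lambda>v. v $ 1 * pderiv_at 1 F u + v $ 2 * pderiv_at 2 F u)) (at u)"
proof -
  have F': "(F has_derivative frechet_derivative F (at u)) (at u)"
    using assms by (simp add: frechet_derivative_works)
  interpret F': bounded_linear "frechet_derivative F (at u)"
    using F' by (rule has_derivative_bounded_linear)
  have "frechet_derivative F (at u) v = v $ 1 * pderiv_at 1 F u + v $ 2 * pderiv_at 2 F u" for v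
  proof -
    have "v = v $ 1 *\<^sub>R axis 1 1 + v $ 2 *\<^sub>R axis 2 1"
      by (simp add: vec_eq_iff forall_2 axis_def)
    then have "frechet_derivative F (at u) v = frechet_derivative F (at u) (v $ 1 *\<^sub>R axis 1 1 + v $ 2 *\<^sub>R axis 2 1)"
      by simp
    then show ?thesis by (simp add: F'.add F'.scaleR pderiv_at_def)
  qed
  then show ?thesis using F' by (metis (no_types, lifting) ext)
qed

lemma pderiv_at_const [simp]: "pderiv_at i (\<lambda>w. c) u = 0"
  by (simp add: pderiv_at_def)

lemma has_derivative_zeroI:
  fixes F :: "real^2 \<Rightarrow> real"
  assumes "F differentiable (at u)" "\<And>i. pderiv_at i F u = 0"
  shows "(F has_derivative (\<lambda>v. 0)) (at u)"
  using has_derivative_pderiv_at[OF assms(1)] assms(2) by simp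

lemma pderiv_at_linear:
  assumes "bounded_linear L" "F differentiable (at u)"
  shows "pderiv_at i (\<lambda>w. L (F w)) u = L (pderiv_at i F u)"
  using pderiv_at_eq[OF bounded_linear.has_derivative[OF assms(1) assms(2)[unfolded frechet_derivative_works]]]
  by (simp add: pderiv_at_def)

lemma pderiv_at_add:
  assumes "F differentiable (at u)" "G differentiable (at u)"
  shows "pderiv_at i (\<lambda>w. F w + G w) u = pderiv_at i F u + pderiv_at i G u"
  using pderiv_at_eq[OF has_derivative_add[OF assms[unfolded frechet_derivative_works]]]
  by (simp add: pderiv_at_def)

lemma pderiv_at_diff:
  assumes "F differentiable (at u)" "G differentiable (at u)"
  shows "pderiv_at i (\<lambda>w. F w - G w) u = pderiv_at i F u - pderiv_at i G u"
  using pderiv_at_eq[OF has_derivative_diff[OF assms[unfolded frechet_derivative_works]]]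
  by (simp add: pderiv_at_def)

lemma pderiv_at_mult:
  fixes F G :: "real^2 \<Rightarrow> real"
  assumes "F differentiable (at u)" "G differentiable (at u)"
  shows "pderiv_at i (\<lambda>w. F w * G w) u = pderiv_at i F u * G u + F u * pderiv_at i G u"
  using pderiv_at_eq[OF has_derivative_mult[OF assms[unfolded frechet_derivative_works]]]
  by (simp add: pderiv_at_def)

section \<open>Derivatives with respect to the projected coordinates\<close>

abbreviation component :: "('a \<Rightarrow> real^3) \<Rightarrow> 3 \<Rightarrow> 'a \<Rightarrow> real" where
  "component x k \<equiv> \<lambda>w. x w $ k"

text \<open>The Jacobian determinant of the projection of the chart to the first two coordinates (its "top view");
  it is also the third coordinate of the cross product of the coordinate tangent vectors.\<close>

definition top_jacobian :: "(real^2 \<Rightarrow> real^3) \<Rightarrow> real^2 \<Rightarrow> real" where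
  "top_jacobian x u =
     pderiv_at 1 (component x 1) u * pderiv_at 2 (component x 2) u
   - pderiv_at 2 (component x 1) u * pderiv_at 1 (component x 2) u"

text \<open>The coefficients in \<open>dF = D 1 F dp + D 2 F dq\<close>, given by Cramer's rule. On a graph over the plane
  these are the ordinary partial derivatives. Defining them by this formula avoids inverting the
  projection.\<close>

definition top_deriv :: "(real^2 \<Rightarrow> real^3) \<Rightarrow> 2 \<Rightarrow> (real^2 \<Rightarrow> real) \<Rightarrow> real^2 \<Rightarrow> real" where
  "top_deriv x k F u =
     (if k = 1
      then pderiv_at 1 F u * pderiv_at 2 (component x 2) u - pderiv_at 2 F u * pderiv_at 1 (component x 2) u
      else pderiv_at 2 F u * pderiv_at 1 (component x 1) u - pderiv_at 1 F u * pderiv_at 2 (component x 1) u)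
     / top_jacobian x u"

lemma matrix_inv_2:
  fixes A :: "real^2^2"
  assumes "det A \<noteq> 0"
  shows "matrix_inv A $ 1 $ 1 = A $ 2 $ 2 / det A" "matrix_inv A $ 1 $ 2 = - A $ 1 $ 2 / det A"
    "matrix_inv A $ 2 $ 1 = - A $ 2 $ 1 / det A" "matrix_inv A $ 2 $ 2 = A $ 1 $ 1 / det A"
proof -
  have "\<exists>B. A ** B = mat 1 \<and> B ** A = mat 1"
    using assms by (simp add: invertible_det_nz[symmetric] invertible_def)
  then have "A ** matrix_inv A = mat 1" unfolding matrix_inv_def by (rule someI2_ex) simp
  then have "(A ** matrix_inv A) $ i $ j = (mat 1 :: real^2^2) $ i $ j" for i j by simp
  then have "A $ i $ 1 * matrix_inv A $ 1 $ j + A $ i $ 2 * matrix_inv A $ 2 $ j = (if i = j then 1 else 0)" for i j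
    by (simp add: matrix_matrix_mult_def sum_2 mat_def)
  from this[of 1 1] this[of 1 2] this[of 2 1] this[of 2 2]
  have e: "A $ 1 $ 1 * matrix_inv A $ 1 $ 1 + A $ 1 $ 2 * matrix_inv A $ 2 $ 1 = 1"
    "A $ 1 $ 1 * matrix_inv A $ 1 $ 2 + A $ 1 $ 2 * matrix_inv A $ 2 $ 2 = 0"
    "A $ 2 $ 1 * matrix_inv A $ 1 $ 1 + A $ 2 $ 2 * matrix_inv A $ 2 $ 1 = 0"
    "A $ 2 $ 1 * matrix_inv A $ 1 $ 2 + A $ 2 $ 2 * matrix_inv A $ 2 $ 2 = 1"
    by simp_all
  have "matrix_inv A $ 1 $ 1 * det A = A $ 2 $ 2" "matrix_inv A $ 1 $ 2 * det A = - A $ 1 $ 2"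
    "matrix_inv A $ 2 $ 1 * det A = - A $ 2 $ 1" "matrix_inv A $ 2 $ 2 * det A = A $ 1 $ 1"
    unfolding det_2 using e by algebra+
  then show "matrix_inv A $ 1 $ 1 = A $ 2 $ 2 / det A" "matrix_inv A $ 1 $ 2 = - A $ 1 $ 2 / det A"
    "matrix_inv A $ 2 $ 1 = - A $ 2 $ 1 / det A" "matrix_inv A $ 2 $ 2 = A $ 1 $ 1 / det A"
    using assms by (simp_all add: field_simps)
qed

locale admissible_chart =
  fixes U :: "(real^2) set" and x :: "real^2 \<Rightarrow> real^3"
  assumes open_U: "open U" and smooth_x: "smooth_on U x"
    and nondegenerate: "u \<in> U \<Longrightarrow> rank (iso_metric x u) = 2"
begin

abbreviation "p \<equiv> component x 1"
abbreviation "q \<equiv> component x 2"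
abbreviation "r \<equiv> component x 3"
abbreviation "J \<equiv> top_jacobian x"
abbreviation "D \<equiv> top_deriv x"

lemma smooth_component [smooth_intros]: "smooth_on U (component x k)"
  by (rule smooth_on_linear[OF open_U bounded_linear_vec_nth smooth_x])

lemma pderiv_component:
  "u \<in> U \<Longrightarrow> pderiv_at i x u $ k = pderiv_at i (component x k) u"
  by (rule pderiv_at_linear[OF bounded_linear_vec_nth smooth_on_differentiable[OF smooth_x], symmetric])

lemma iso_metric_entry:
  "u \<in> U \<Longrightarrow> iso_metric x u $ i $ j = pderiv_at i p u * pderiv_at j p u + pderiv_at i q u * pderiv_at j q u"
  by (simp add: iso_metric_def iso_inner_def pderiv_component)

lemma det_iso_metric: "u \<in> U \<Longrightarrow> det (iso_metric x u) = (J u)\<^sup>2"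
  by (simp add: det_2 iso_metric_entry top_jacobian_def power2_eq_square algebra_simps)

lemma jacobian_nonzero: "u \<in> U \<Longrightarrow> J u \<noteq> 0"
  using nondegenerate[of u] det_iso_metric[of u] det_eq_0_rank[of "iso_metric x u"] by auto

lemma smooth_jacobian [smooth_intros]: "smooth_on U J"
  unfolding top_jacobian_def[abs_def] by (intro smooth_intros open_U)

lemma smooth_top_deriv [smooth_intros]:
  assumes "smooth_on U F"
  shows "smooth_on U (D k F)"
proof (cases "k = 1")
  case True
  then show ?thesis
    unfolding top_deriv_def[abs_def]
    by (simp, intro smooth_intros open_U assms jacobian_nonzero) 
next
  case False
  then show ?thesis
    unfolding top_deriv_def[abs_def]
    by (simp, intro smooth_intros open_U assms jacobian_nonzero)
qed

text \<open>The equation \<open>dF = D 1 F dp + D 2 F dq\<close> that the quotients were designed to solve.\<close>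

lemma pderiv_via_top_deriv:
  assumes "u \<in> U"
  shows "pderiv_at i F u = D 1 F u * pderiv_at i p u + D 2 F u * pderiv_at i q u"
proof -
  have "pderiv_at i F u * J u = (D 1 F u * J u) * pderiv_at i p u + (D 2 F u * J u) * pderiv_at i q u"
    using exhaust_2[of i] jacobian_nonzero[OF assms]
    by (auto simp: top_deriv_def) (auto simp: top_jacobian_def algebra_simps)
  then have "pderiv_at i F u * J u = (D 1 F u * pderiv_at i p u + D 2 F u * pderiv_at i q u) * J u"
    by (simp add: algebra_simps)
  then show ?thesis using jacobian_nonzero[OF assms] by simp
qed

text \<open>\<open>dp\<close> and \<open>dq\<close> are independent, so \<open>dF\<close> has only one expansion in them.\<close>

lemma top_deriv_unique:
  assumes "u \<in> U" "\<And>i. pderiv_at i F u = a * pderiv_at i p u + b * pderiv_at i q u"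
  shows "D 1 F u = a" "D 2 F u = b"
proof -
  have "D 1 F u * J u = a * J u" "D 2 F u * J u = b * J u"
    using jacobian_nonzero[OF assms(1)] assms(2)[of 1] assms(2)[of 2]
    by (auto simp: top_deriv_def) (auto simp: top_jacobian_def algebra_simps)
  then show "D 1 F u = a" "D 2 F u = b" using jacobian_nonzero[OF assms(1)] by auto
qed

lemma top_deriv_cong:
  assumes "u \<in> U" "\<And>w. w \<in> U \<Longrightarrow> F w = G w"
  shows "D k F u = D k G u"
  using pderiv_at_cong[OF open_U assms] by (simp add: top_deriv_def)

lemma top_deriv_const [simp]: "D k (\<lambda>w. c) u = 0"
  by (simp add: top_deriv_def)

lemma top_deriv_add:
  assumes "u \<in> U" "smooth_on U F" "smooth_on U G"
  shows "D k (\<lambda>w. F w + G w) u = D k F u + D k G u"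
  using smooth_on_differentiable[OF assms(2,1)] smooth_on_differentiable[OF assms(3,1)]
  by (simp add: top_deriv_def pderiv_at_add add_divide_distrib[symmetric] algebra_simps)

lemma top_deriv_mult:
  assumes "u \<in> U" "smooth_on U F" "smooth_on U G"
  shows "D k (\<lambda>w. F w * G w) u = D k F u * G u + F u * D k G u"
  using smooth_on_differentiable[OF assms(2,1)] smooth_on_differentiable[OF assms(3,1)] jacobian_nonzero[OF assms(1)]
  by (simp add: top_deriv_def pderiv_at_mult field_simps)

lemma top_deriv_cmult:
  assumes "u \<in> U" "smooth_on U F"
  shows "D k (\<lambda>w. c * F w) u = c * D k F u"
  using top_deriv_mult[OF assms(1) smooth_on_const assms(2)] by simp

text \<open>The product rule applied to \<open>pderiv_via_top_deriv\<close>. It serves twice: its antisymmetric part gives the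
  commutation of \<open>D 1\<close> and \<open>D 2\<close>, and for \<open>F = r\<close> it computes the second fundamental form.\<close>

lemma second_pderiv_via_top_deriv:
  assumes "u \<in> U" "smooth_on U F"
  shows "pderiv_at j (pderiv_at i F) u
      = pderiv_at j (D 1 F) u * pderiv_at i p u + D 1 F u * pderiv_at j (pderiv_at i p) u
      + (pderiv_at j (D 2 F) u * pderiv_at i q u + D 2 F u * pderiv_at j (pderiv_at i q) u)"
proof -
  have d: "G differentiable (at u)" if "smooth_on U G" for G :: "real^2 \<Rightarrow> real"
    using smooth_on_differentiable[OF that assms(1)] .
  have "pderiv_at j (pderiv_at i F) u = pderiv_at j (\<lambda>w. D 1 F w * pderiv_at i p w + D 2 F w * pderiv_at i q w) u"
    using pderiv_via_top_deriv by (intro pderiv_at_cong[OF open_U assms(1)])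
  also have "\<dots> = pderiv_at j (\<lambda>w. D 1 F w * pderiv_at i p w) u + pderiv_at j (\<lambda>w. D 2 F w * pderiv_at i q w) u"
    by (intro pderiv_at_add d smooth_intros open_U assms(2))
  also have "pderiv_at j (\<lambda>w. D 1 F w * pderiv_at i p w) u =
      pderiv_at j (D 1 F) u * pderiv_at i p u + D 1 F u * pderiv_at j (pderiv_at i p) u"
    by (intro pderiv_at_mult d smooth_intros open_U assms(2))
  also have "pderiv_at j (\<lambda>w. D 2 F w * pderiv_at i q w) u =
      pderiv_at j (D 2 F) u * pderiv_at i q u + D 2 F u * pderiv_at j (pderiv_at i q) u"
    by (intro pderiv_at_mult d smooth_intros open_U assms(2))
  finally show ?thesis .
qed

text \<open>Exchanging the two coordinate derivatives of \<open>F\<close>, \<open>p\<close> and \<open>q\<close> in the previous formula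
  leaves the vanishing of the sum of the exterior products of \<open>d (D 1 F)\<close> with \<open>dp\<close> and of \<open>d (D 2 F)\<close>
  with \<open>dq\<close>. This sum is \<open>J\<close> times the difference of \<open>D 1 (D 2 F)\<close> and \<open>D 2 (D 1 F)\<close>.\<close>

lemma top_deriv_commute:
  assumes "u \<in> U" "smooth_on U F"
  shows "D i (D j F) u = D j (D i F) u"
proof -
  note second = second_pderiv_via_top_deriv[OF assms]
  have sym: "pderiv_at 2 (pderiv_at 1 G) u = pderiv_at 1 (pderiv_at 2 G) u" if "smooth_on U G" for G :: "real^2 \<Rightarrow> real"
    using pderiv_commute[OF open_U that assms(1)] .
  have "pderiv_at 2 (D 1 F) u * pderiv_at 1 p u + pderiv_at 2 (D 2 F) u * pderiv_at 1 q u
      = pderiv_at 1 (D 1 F) u * pderiv_at 2 p u + pderiv_at 1 (D 2 F) u * pderiv_at 2 q u"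
    using second[of 2 1] second[of 1 2] sym[OF assms(2)] sym[of p] sym[of q] smooth_component by simp
  then have "D 2 (D 1 F) u = D 1 (D 2 F) u"
    by (simp add: top_deriv_def divide_cancel_right algebra_simps)
  then show ?thesis using exhaust_2[of i] exhaust_2[of j] by auto
qed

text \<open>In the flat coordinates \<open>p\<close>, \<open>q\<close> the Laplace-Beltrami operator must be the flat Laplacian. In the chart it
  is, after division by \<open>\<bar>J\<bar>\<close>, the divergence of the flux \<open>\<bar>J\<bar> g\<^sup>-\<^sup>1 \<nabla>\<phi>\<close>. Up to the locally constant sign
  of \<open>J\<close>, this flux corresponds to the 1-form \<open>D 1 \<phi> dq - D 2 \<phi> dp\<close>; its components are \<open>?S1\<close> and
  \<open>?S2\<close> below. The mixed derivatives of \<open>p\<close> and \<open>q\<close> cancel in the divergence, so only the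
  derivatives of \<open>D 1 \<phi>\<close> and \<open>D 2 \<phi>\<close> remain.\<close>

lemma laplace_beltrami_eq:
  assumes "u \<in> U" "smooth_on U \<phi>"
  shows "laplace_beltrami x \<phi> u = D 1 (D 1 \<phi>) u + D 2 (D 2 \<phi>) u"
proof -
  \<comment> \<open>On the neighbourhood \<open>V\<close> of \<open>u\<close> the Jacobian keeps its sign, so that \<open>\<bar>J\<bar> = s * J\<close> is smooth.\<close>
  define s where "s = sgn (J u)"
  define V where "V = {w \<in> U. s * J w > 0}"
  have s2: "s * s = 1" using jacobian_nonzero[OF assms(1)] by (auto simp: s_def sgn_if)
  have "u \<in> V" using assms(1) jacobian_nonzero[OF assms(1)] by (simp add: V_def s_def sgn_if)
  have "V = U \<inter> (\<lambda>w. s * J w) -` {0<..}" by (auto simp: V_def)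
  moreover have "continuous_on U (\<lambda>w. s * J w)"
    by (intro smooth_on_continuous smooth_intros open_U)
  ultimately have "open V" using continuous_open_preimage[OF _ open_U open_greaterThan] by metis
  have "V \<subseteq> U" by (auto simp: V_def)
  have root: "sqrt (det (iso_metric x w)) = s * J w" if "w \<in> V" for w
  proof -
    have "(J w)\<^sup>2 = (s * J w)\<^sup>2" using s2 by (simp add: power2_eq_square mult.assoc mult.left_commute)
    then show ?thesis using that by (simp add: det_iso_metric V_def)
  qed
  have J0: "J w \<noteq> 0" if "w \<in> V" for w using that \<open>V \<subseteq> U\<close> jacobian_nonzero by blast
  have sm: "smooth_on U F \<Longrightarrow> smooth_on V F" for F :: "real^2 \<Rightarrow> real"
    using smooth_on_subset \<open>V \<subseteq> U\<close> by blast
  have dV: "F differentiable (at u)" if "smooth_on V F" for F :: "real^2 \<Rightarrow> real"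
    using smooth_on_differentiable[OF that \<open>u \<in> V\<close>] .
  have dU: "F differentiable (at u)" if "smooth_on U F" for F :: "real^2 \<Rightarrow> real"
    using dV[OF sm[OF that]] .
  \<comment> \<open>\<open>?c i j\<close> is the cofactor of the metric; in the two-element index type \<open>3 - i\<close> is the other index.\<close>
  let ?g = "\<lambda>i j w. pderiv_at i p w * pderiv_at j p w + pderiv_at i q w * pderiv_at j q w"
  let ?c = "\<lambda>i j w. if i = j then ?g (3 - i) (3 - i) w else - ?g 1 2 w"
  let ?t = "\<lambda>i j w. s * (?c i j w / J w) * pderiv_at j \<phi> w"
  have smooth_t: "smooth_on V (?t i j)" for i j
    by (cases "i = j"; simp; intro smooth_intros \<open>open V\<close> sm assms(2) J0 smooth_component smooth_jacobian)
  have integrand: "sqrt (det (iso_metric x w)) * matrix_inv (iso_metric x w) $ i $ j * pderiv_at j \<phi> w = ?t i j w"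
    if "w \<in> V" for w i j
  proof -
    have "w \<in> U" using that \<open>V \<subseteq> U\<close> by blast
    have "det (iso_metric x w) \<noteq> 0" using det_iso_metric[OF \<open>w \<in> U\<close>] J0[OF that] by simp
    note inv = matrix_inv_2[OF this]
    have "matrix_inv (iso_metric x w) $ i $ j = ?c i j w / (J w)\<^sup>2"
      using exhaust_2[of i] exhaust_2[of j]
      by (auto simp: inv det_iso_metric[OF \<open>w \<in> U\<close>] iso_metric_entry[OF \<open>w \<in> U\<close>] mult.commute)
    then show ?thesis using J0[OF that] by (simp add: root[OF that] power2_eq_square)
  qed
  let ?S1 = "\<lambda>w. pderiv_at 2 q w * D 1 \<phi> w - pderiv_at 2 p w * D 2 \<phi> w"
  let ?S2 = "\<lambda>w. pderiv_at 1 p w * D 2 \<phi> w - pderiv_at 1 q w * D 1 \<phi> w"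
  have flux1: "?t 1 1 w + ?t 1 2 w = s * ?S1 w" and flux2: "?t 2 1 w + ?t 2 2 w = s * ?S2 w" if "w \<in> V" for w
    using J0[OF that] by (auto simp: top_deriv_def field_simps)
  have S: "pderiv_at i (\<lambda>w. s * F w) u = s * pderiv_at i F u" if "smooth_on U F" for F :: "real^2 \<Rightarrow> real" and i
    using pderiv_at_mult[where F = "\<lambda>w. s" and G = F and u = u and i = i] dU[OF that] by simp
  have smS: "smooth_on U ?S1" "smooth_on U ?S2"
    by (intro smooth_intros open_U assms(2))+
  have 1: "pderiv_at 1 (?t 1 1) u + pderiv_at 1 (?t 1 2) u = s * pderiv_at 1 ?S1 u"
    using pderiv_at_add[OF dV[OF smooth_t[of 1 1]] dV[OF smooth_t[of 1 2]], where i = 1]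
      pderiv_at_cong[OF \<open>open V\<close> \<open>u \<in> V\<close> flux1, where i = 1] S[OF smS(1)] by simp
  have 2: "pderiv_at 2 (?t 2 1) u + pderiv_at 2 (?t 2 2) u = s * pderiv_at 2 ?S2 u"
    using pderiv_at_add[OF dV[OF smooth_t[of 2 1]] dV[OF smooth_t[of 2 2]], where i = 2]
      pderiv_at_cong[OF \<open>open V\<close> \<open>u \<in> V\<close> flux2, where i = 2] S[OF smS(2)] by simp
  have dd: "pderiv_at 2 p differentiable (at u)" "pderiv_at 2 q differentiable (at u)"
     "pderiv_at 1 p differentiable (at u)" "pderiv_at 1 q differentiable (at u)"
     "D 1 \<phi> differentiable (at u)" "D 2 \<phi> differentiable (at u)"
    by (intro dU smooth_intros open_U assms(2))+
  have prods: "(\<lambda>w. pderiv_at 2 q w * D 1 \<phi> w) differentiable (at u)" "(\<lambda>w. pderiv_at 2 p w * D 2 \<phi> w) differentiable (at u)"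
    "(\<lambda>w. pderiv_at 1 p w * D 2 \<phi> w) differentiable (at u)" "(\<lambda>w. pderiv_at 1 q w * D 1 \<phi> w) differentiable (at u)"
    by (intro dU smooth_intros open_U assms(2))+
  have comm: "pderiv_at 1 (pderiv_at 2 G) u = pderiv_at 2 (pderiv_at 1 G) u" if "smooth_on U G" for G :: "real^2 \<Rightarrow> real"
    using pderiv_commute[OF open_U that assms(1)] .
  have div: "pderiv_at 1 ?S1 u + pderiv_at 2 ?S2 u = J u * (D 1 (D 1 \<phi>) u + D 2 (D 2 \<phi>) u)"
  proof -
    have "J u * (D 1 (D 1 \<phi>) u + D 2 (D 2 \<phi>) u)
      = pderiv_at 1 (D 1 \<phi>) u * pderiv_at 2 q u - pderiv_at 2 (D 1 \<phi>) u * pderiv_at 1 q u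
      + (pderiv_at 2 (D 2 \<phi>) u * pderiv_at 1 p u - pderiv_at 1 (D 2 \<phi>) u * pderiv_at 2 p u)"
      using jacobian_nonzero[OF assms(1)] by (simp add: top_deriv_def[of x _ "D _ \<phi>"] distrib_left)
    then show ?thesis
      using comm[OF smooth_component[of 1]] comm[OF smooth_component[of 2]]
      by (simp add: pderiv_at_diff prods pderiv_at_mult dd algebra_simps)
  qed
  have "pderiv_at i (\<lambda>w. sqrt (det (iso_metric x w)) * matrix_inv (iso_metric x w) $ i $ j * pderiv_at j \<phi> w) u
      = pderiv_at i (?t i j) u" for i j
    by (rule pderiv_at_cong[OF \<open>open V\<close> \<open>u \<in> V\<close> integrand])
  then have "laplace_beltrami x \<phi> u = 1 / (s * J u) * (s * pderiv_at 1 ?S1 u + s * pderiv_at 2 ?S2 u)"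
    unfolding laplace_beltrami_def sum_2 root[OF \<open>u \<in> V\<close>] using 1 2 by simp
  also have "\<dots> = 1 / (s * J u) * (s * (pderiv_at 1 ?S1 u + pderiv_at 2 ?S2 u))"
    by (simp only: distrib_left)
  also have "\<dots> = D 1 (D 1 \<phi>) u + D 2 (D 2 \<phi>) u"
    unfolding div using s2 J0[OF \<open>u \<in> V\<close>] by (cases "s = 0") simp_all
  finally show ?thesis .
qed

section \<open>Normals and mean curvature\<close>

lemma minimal_normal_component:
  assumes "u \<in> U"
  shows "minimal_normal x u $ 1 = - D 1 r u" "minimal_normal x u $ 2 = - D 2 r u" "minimal_normal x u $ 3 = 1"
proof -
  have third: "cross3 (pderiv_at 1 x u) (pderiv_at 2 x u) $ 3 = J u"
    by (simp add: cross3_def pderiv_component assms top_jacobian_def algebra_simps)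
  show "minimal_normal x u $ 1 = - D 1 r u" "minimal_normal x u $ 2 = - D 2 r u" "minimal_normal x u $ 3 = 1"
    using jacobian_nonzero[OF assms]
    by (simp_all add: minimal_normal_def Let_def third)
       (simp_all add: cross3_def pderiv_component assms top_deriv_def divide_simps)
qed

lemma parabolic_normal_component:
  assumes "u \<in> U"
  shows "parabolic_normal x u $ 1 = - D 1 r u" "parabolic_normal x u $ 2 = - D 2 r u"
    "parabolic_normal x u $ 3 = 1/2 - 1/2 * ((D 1 r u)\<^sup>2 + (D 2 r u)\<^sup>2)"
  by (simp_all add: parabolic_normal_def minimal_normal_component assms Let_def)

text \<open>The second fundamental form is the Hessian of the height with respect to \<open>p\<close> and \<open>q\<close>, pulled back by the
  projection: the first derivatives \<open>D 1 r\<close>, \<open>D 2 r\<close> cancel against the first two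
  coordinates of the normal.\<close>

lemma second_form_entry:
  assumes "u \<in> U"
  shows "second_form x u $ i $ j
    = pderiv_at j (D 1 r) u * pderiv_at i p u + pderiv_at j (D 2 r) u * pderiv_at i q u"
proof -
  have comp: "pderiv_at j (pderiv_at i x) u $ k = pderiv_at j (pderiv_at i (component x k)) u" for k
  proof -
    have "pderiv_at j (pderiv_at i x) u $ k = pderiv_at j (component (pderiv_at i x) k) u"
      using pderiv_at_linear[OF bounded_linear_vec_nth
          smooth_on_differentiable[OF smooth_on_pderiv[OF smooth_x] assms]] by simp
    also have "\<dots> = pderiv_at j (pderiv_at i (component x k)) u"
      by (intro pderiv_at_cong[OF open_U assms] pderiv_component)
    finally show ?thesis .
  qed
  show ?thesis
    using second_pderiv_via_top_deriv[OF assms smooth_component[of 3], of j i]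
    by (simp add: second_form_def inner_vec_def sum_3 comp minimal_normal_component assms)
qed

text \<open>With \<open>A\<close> the Jacobian matrix of the projection and \<open>S\<close> the Hessian of the height, the metric is
  \<open>A\<^sup>T A\<close> and the second fundamental form \<open>A\<^sup>T S A\<close>, so the trace of their quotient is the trace of
  \<open>S\<close>.\<close>

lemma iso_mean_curvature_eq:
  assumes "u \<in> U"
  shows "iso_mean_curvature x u = 1/2 * (D 1 (D 1 r) u + D 2 (D 2 r) u)"
proof -
  let ?a = "pderiv_at 1 p u" and ?b = "pderiv_at 2 p u" and ?c = "pderiv_at 1 q u" and ?d = "pderiv_at 2 q u"
  let ?s = "D 1 (D 1 r) u" and ?t = "D 1 (D 2 r) u" and ?w = "D 2 (D 2 r) u"
  have comm: "D 2 (D 1 r) u = ?t"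
    by (rule top_deriv_commute[OF assms smooth_component])
  have h: "second_form x u $ i $ j
     = (?s * pderiv_at j p u + ?t * pderiv_at j q u) * pderiv_at i p u
     + (?t * pderiv_at j p u + ?w * pderiv_at j q u) * pderiv_at i q u" for i j
    using pderiv_via_top_deriv[OF assms, of j "D 1 r"] pderiv_via_top_deriv[OF assms, of j "D 2 r"]
    by (simp add: second_form_entry[OF assms] comm)
  have J: "J u = ?a * ?d - ?b * ?c" by (simp add: top_jacobian_def)
  have den: "iso_metric x u $ 1 $ 1 * iso_metric x u $ 2 $ 2 - (iso_metric x u $ 1 $ 2)\<^sup>2 = (J u)\<^sup>2"
    unfolding iso_metric_entry[OF assms] J by algebra
  have num: "iso_metric x u $ 1 $ 1 * second_form x u $ 2 $ 2 - 2 * iso_metric x u $ 1 $ 2 * second_form x u $ 1 $ 2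
      + iso_metric x u $ 2 $ 2 * second_form x u $ 1 $ 1 = (?s + ?w) * (J u)\<^sup>2"
    unfolding iso_metric_entry[OF assms] h J by algebra
  show ?thesis
    unfolding iso_mean_curvature_def Let_def den num using jacobian_nonzero[OF assms] by simp
qed

lemma smooth_iso_mean_curvature: "smooth_on U (iso_mean_curvature x)"
proof (rule smooth_on_cong[OF open_U])
  show "smooth_on U (\<lambda>u. 1/2 * (D 1 (D 1 r) u + D 2 (D 2 r) u))"
    by (intro smooth_intros open_U)
qed (simp add: iso_mean_curvature_eq)

section \<open>Harmonicity of the normals in a chart\<close>

lemma laplace_beltrami_eq_on:
  assumes "u \<in> U" "smooth_on U \<psi>" "\<And>w. w \<in> U \<Longrightarrow> \<phi> w = \<psi> w"
  shows "laplace_beltrami x \<phi> u = D 1 (D 1 \<psi>) u + D 2 (D 2 \<psi>) u"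
proof -
  have "smooth_on U \<phi>"
    using smooth_on_cong[OF open_U _ assms(2), of \<phi>] assms(3) by simp
  moreover have "D k (D k \<phi>) u = D k (D k \<psi>) u" for k
    by (intro top_deriv_cong assms)
  ultimately show ?thesis using laplace_beltrami_eq[OF assms(1)] by simp
qed

lemma laplace_beltrami_const_on:
  assumes "u \<in> U" "\<And>w. w \<in> U \<Longrightarrow> \<phi> w = c"
  shows "laplace_beltrami x \<phi> u = 0"
proof -
  have "D k (\<lambda>w. c) = (\<lambda>w. 0)" for k c by (rule ext) simp
  then show ?thesis using laplace_beltrami_eq_on[OF assms(1) smooth_on_const assms(2)] by simp
qed

text \<open>The Laplacian commutes with \<open>D k\<close>, and the Laplacian of the height is twice the mean curvature. The
  function \<open>\<phi>\<close> is constrained on \<open>U\<close> only, since the normal has the form \<open>- D k r\<close> only there.\<close>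

lemma laplace_beltrami_neg_slope:
  assumes "u \<in> U" "\<And>w. w \<in> U \<Longrightarrow> \<phi> w = - D k r w"
  shows "laplace_beltrami x \<phi> u = - 2 * D k (iso_mean_curvature x) u"
proof -
  have third: "D i (D i (\<lambda>w. -1 * D k r w)) u = - D k (D i (D i r)) u" for i
  proof -
    have "D i (D i (\<lambda>w. -1 * D k r w)) u = D i (\<lambda>w. -1 * D i (D k r) w) u"
      by (intro top_deriv_cong assms(1) top_deriv_cmult smooth_intros)
    also have "\<dots> = -1 * D i (D i (D k r)) u"
      by (intro top_deriv_cmult assms(1) smooth_intros)
    also have "D i (D i (D k r)) u = D i (D k (D i r)) u"
      by (intro top_deriv_cong[OF assms(1)] top_deriv_commute smooth_intros)
    also have "\<dots> = D k (D i (D i r)) u"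
      by (intro top_deriv_commute[OF assms(1)] smooth_intros)
    finally show ?thesis by simp
  qed
  have "D k (iso_mean_curvature x) u = D k (\<lambda>w. 1/2 * (D 1 (D 1 r) w + D 2 (D 2 r) w)) u"
    by (intro top_deriv_cong assms(1) iso_mean_curvature_eq)
  also have "\<dots> = 1/2 * D k (\<lambda>w. D 1 (D 1 r) w + D 2 (D 2 r) w) u"
    by (intro top_deriv_cmult assms(1) smooth_intros open_U)
  also have "D k (\<lambda>w. D 1 (D 1 r) w + D 2 (D 2 r) w) u = D k (D 1 (D 1 r)) u + D k (D 2 (D 2 r)) u"
    by (intro top_deriv_add assms(1) smooth_intros open_U)
  finally have "D k (iso_mean_curvature x) u = 1/2 * (D k (D 1 (D 1 r)) u + D k (D 2 (D 2 r)) u)" .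
  moreover have "laplace_beltrami x \<phi> u = D 1 (D 1 (\<lambda>w. -1 * D k r w)) u + D 2 (D 2 (\<lambda>w. -1 * D k r w)) u"
    by (rule laplace_beltrami_eq_on[OF assms(1)]) (intro smooth_intros open_U, simp add: assms(2))
  ultimately show ?thesis unfolding third by simp
qed

lemma vector_laplace_minimal_normal:
  assumes "u \<in> U"
  shows "vector_laplace_beltrami x (minimal_normal x) u = 0 \<longleftrightarrow> (\<forall>k. D k (iso_mean_curvature x) u = 0)"
  using laplace_beltrami_neg_slope[OF assms minimal_normal_component(1)]
    laplace_beltrami_neg_slope[OF assms minimal_normal_component(2)]
    laplace_beltrami_const_on[OF assms minimal_normal_component(3)]
  by (simp add: vec_eq_iff forall_3 forall_2 vector_laplace_beltrami_def)

text \<open>For harmonic functions \<open>a\<close>, \<open>b\<close> the Laplacian of \<open>a\<^sup>2 + b\<^sup>2\<close> is \<open>2 (\<bar>\<nabla>a\<bar>\<^sup>2 + \<bar>\<nabla>b\<bar>\<^sup>2)\<close>. Apply this to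
  \<open>a = D 1 r\<close> and \<open>b = D 2 r\<close>: the first two coordinates of the parabolic normal say that they are
  harmonic, and the third one that their gradients vanish.\<close>

lemma parabolic_harmonic_imp_flat:
  assumes harm: "vector_laplace_beltrami x (parabolic_normal x) u = 0" and "u \<in> U"
  shows "D i (D k r) u = 0"
proof -
  let ?a = "D 1 r" and ?b = "D 2 r"
  let ?\<psi> = "\<lambda>w. 1/2 + (- 1/2) * (?a w * ?a w + ?b w * ?b w)"
  have twice: "D i (D i (\<lambda>w. -1 * D j r w)) u = - D i (D i (D j r)) u" for i j
  proof -
    have "D i (D i (\<lambda>w. -1 * D j r w)) u = D i (\<lambda>w. -1 * D i (D j r) w) u"
      by (intro top_deriv_cong \<open>u \<in> U\<close> top_deriv_cmult smooth_intros)
    also have "\<dots> = -1 * D i (D i (D j r)) u"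
      by (intro top_deriv_cmult \<open>u \<in> U\<close> smooth_intros)
    finally show ?thesis by simp
  qed
  have comp: "laplace_beltrami x (component (parabolic_normal x) j) u = 0" for j
    using harm by (simp add: vec_eq_iff vector_laplace_beltrami_def)
  have \<Delta>: "D 1 (D 1 \<psi>) u + D 2 (D 2 \<psi>) u = 0"
    if "smooth_on U \<psi>" "\<And>w. w \<in> U \<Longrightarrow> parabolic_normal x w $ j = \<psi> w" for \<psi> j
    using laplace_beltrami_eq_on[OF \<open>u \<in> U\<close> that] comp[of j] by simp
  have \<Delta>a: "D 1 (D 1 (\<lambda>w. -1 * ?a w)) u + D 2 (D 2 (\<lambda>w. -1 * ?a w)) u = 0"
    by (rule \<Delta>[of _ 1]) (intro smooth_intros open_U, simp add: parabolic_normal_component)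
  have \<Delta>b: "D 1 (D 1 (\<lambda>w. -1 * ?b w)) u + D 2 (D 2 (\<lambda>w. -1 * ?b w)) u = 0"
    by (rule \<Delta>[of _ 2]) (intro smooth_intros open_U, simp add: parabolic_normal_component)
  have \<Delta>\<psi>: "D 1 (D 1 ?\<psi>) u + D 2 (D 2 ?\<psi>) u = 0"
    by (rule \<Delta>[of _ 3]) (intro smooth_intros open_U, simp add: parabolic_normal_component power2_eq_square)
  have \<psi>1: "D i ?\<psi> w = -1 * (?a w * D i ?a w + ?b w * D i ?b w)" if "w \<in> U" for i w
  proof -
    have "D i ?\<psi> w = D i (\<lambda>w. 1/2) w + D i (\<lambda>w. (- 1/2) * (?a w * ?a w + ?b w * ?b w)) w"
      by (intro top_deriv_add that smooth_intros open_U)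
    also have "D i (\<lambda>w. (- 1/2) * (?a w * ?a w + ?b w * ?b w)) w = (- 1/2) * D i (\<lambda>w. ?a w * ?a w + ?b w * ?b w) w"
      by (intro top_deriv_cmult that smooth_intros open_U)
    also have "D i (\<lambda>w. ?a w * ?a w + ?b w * ?b w) w = D i (\<lambda>w. ?a w * ?a w) w + D i (\<lambda>w. ?b w * ?b w) w"
      by (intro top_deriv_add that smooth_intros open_U)
    also have "D i (\<lambda>w. ?a w * ?a w) w = D i ?a w * ?a w + ?a w * D i ?a w"
      by (intro top_deriv_mult that smooth_intros open_U)
    also have "D i (\<lambda>w. ?b w * ?b w) w = D i ?b w * ?b w + ?b w * D i ?b w"
      by (intro top_deriv_mult that smooth_intros open_U)
    finally show ?thesis by (simp add: algebra_simps)
  qed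
  have \<psi>2: "D i (D i ?\<psi>) u = - ((D i ?a u)\<^sup>2 + ?a u * D i (D i ?a) u + (D i ?b u)\<^sup>2 + ?b u * D i (D i ?b) u)" for i
  proof -
    have "D i (D i ?\<psi>) u = D i (\<lambda>w. -1 * (?a w * D i ?a w + ?b w * D i ?b w)) u"
      by (intro top_deriv_cong \<open>u \<in> U\<close> \<psi>1)
    also have "\<dots> = -1 * D i (\<lambda>w. ?a w * D i ?a w + ?b w * D i ?b w) u"
      by (intro top_deriv_cmult \<open>u \<in> U\<close> smooth_intros open_U)
    also have "D i (\<lambda>w. ?a w * D i ?a w + ?b w * D i ?b w) u = D i (\<lambda>w. ?a w * D i ?a w) u + D i (\<lambda>w. ?b w * D i ?b w) u"
      by (intro top_deriv_add \<open>u \<in> U\<close> smooth_intros open_U)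
    also have "D i (\<lambda>w. ?a w * D i ?a w) u = D i ?a u * D i ?a u + ?a u * D i (D i ?a) u"
      by (intro top_deriv_mult \<open>u \<in> U\<close> smooth_intros open_U)
    also have "D i (\<lambda>w. ?b w * D i ?b w) u = D i ?b u * D i ?b u + ?b u * D i (D i ?b) u"
      by (intro top_deriv_mult \<open>u \<in> U\<close> smooth_intros open_U)
    finally show ?thesis by (simp add: power2_eq_square)
  qed
  have a0: "D 2 (D 2 ?a) u = - D 1 (D 1 ?a) u" and b0: "D 2 (D 2 ?b) u = - D 1 (D 1 ?b) u"
    using \<Delta>a \<Delta>b unfolding twice by auto
  have "(D 1 ?a u)\<^sup>2 + (D 1 ?b u)\<^sup>2 + (D 2 ?a u)\<^sup>2 + (D 2 ?b u)\<^sup>2 = 0"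
    using \<Delta>\<psi> unfolding \<psi>2 a0 b0 by (simp add: algebra_simps)
  then have "D 1 ?a u = 0 \<and> D 1 ?b u = 0 \<and> D 2 ?a u = 0 \<and> D 2 ?b u = 0"
    by (simp add: add_nonneg_eq_0_iff)
  then show ?thesis
    using exhaust_2[of i] exhaust_2[of k] by auto
qed

lemma constant_slopes_imp_parabolic_harmonic:
  assumes "\<And>w k. w \<in> U \<Longrightarrow> D k r w = a k" "u \<in> U"
  shows "vector_laplace_beltrami x (parabolic_normal x) u = 0"
proof -
  have "laplace_beltrami x (component (parabolic_normal x) 1) u = 0"
    "laplace_beltrami x (component (parabolic_normal x) 2) u = 0"
    "laplace_beltrami x (component (parabolic_normal x) 3) u = 0"
    by (rule laplace_beltrami_const_on[OF assms(2)], simp add: parabolic_normal_component assms(1))+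
  then show ?thesis by (simp add: vec_eq_iff forall_3 vector_laplace_beltrami_def)
qed

lemma zero_top_deriv_imp_zero_derivative:
  assumes "u \<in> U" "smooth_on U F" "\<And>k. D k F u = 0"
  shows "(F has_derivative (\<lambda>v. 0)) (at u)"
  using has_derivative_zeroI[OF smooth_on_differentiable[OF assms(2,1)]]
    pderiv_via_top_deriv[OF assms(1), of _ F] assms(3) by simp

end

section \<open>Charts of a surface\<close>

lemma local_parametrizationD:
  assumes "local_parametrization M U x"
  shows "open U" "smooth_on U x" "x ` U \<subseteq> M" "continuous_on U x" "inj_on x U"
    "\<And>u. u \<in> U \<Longrightarrow> inj (frechet_derivative x (at u))"
  using assms openin_imp_subset[of euclidean M "x ` U"]
  by (auto simp: local_parametrization_def homeomorphism_def smooth_on_continuous intro: inj_on_inverseI)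

lemma chart_image_openin:
  assumes "local_parametrization M U x" "open V" "V \<subseteq> U"
  shows "openin (top_of_set M) (x ` V)"
proof -
  obtain y where "homeomorphism U (x ` U) x y" and o: "openin (top_of_set M) (x ` U)"
    using assms(1) by (auto simp: local_parametrization_def)
  then have "openin (top_of_set (x ` U)) (x ` V)"
    using homeomorphism_imp_open_map open_openin_trans[of U V] local_parametrizationD(1)[OF assms(1)] assms(2,3)
    by (metis openin_open_eq)
  then show ?thesis using o openin_trans by blast
qed

text \<open>The map \<open>\<tau>\<close> is the inverse of \<open>x'\<close> after \<open>x\<close>. It is continuous because charts are homeomorphisms onto
  relatively open sets, and differentiable because it lifts \<open>x\<close> through the immersion
  \<open>x'\<close>.\<close>

lemma differentiable_transition:
  assumes M: "local_parametrization M U x" and M': "local_parametrization M U' x'"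
    and u: "u \<in> U" "u' \<in> U'" "x u = x' u'"
  obtains \<tau> W where "open W" "u \<in> W" "W \<subseteq> U" "\<tau> u = u'" "\<tau> ` W \<subseteq> U'"
    "\<And>w. w \<in> W \<Longrightarrow> x' (\<tau> w) = x w" "\<tau> differentiable (at u)"
proof -
  note A = local_parametrizationD[OF M] and B = local_parametrizationD[OF M']
  obtain y where y: "homeomorphism U' (x' ` U') x' y" and o: "openin (top_of_set M) (x' ` U')"
    using M' by (auto simp: local_parametrization_def)
  obtain T where T: "open T" "x' ` U' = M \<inter> T" using o by (auto simp: openin_open)
  define W where "W = U \<inter> x -` T"
  have "open W" unfolding W_def using continuous_open_preimage[OF A(4,1) T(1)] .
  have xW: "x w \<in> x' ` U'" if "w \<in> W" for w using that A(3) T(2) by (auto simp: W_def)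
  have "u \<in> W" using u T(2) by (auto simp: W_def)
  have "W \<subseteq> U" by (auto simp: W_def)
  define \<tau> where "\<tau> = (\<lambda>w. y (x w))"
  have \<tau>u: "\<tau> u = u'" using u y by (simp add: \<tau>_def homeomorphism_def)
  have \<tau>W: "\<tau> ` W \<subseteq> U'" using xW y by (auto simp: \<tau>_def homeomorphism_def)
  have x\<tau>: "x' (\<tau> w) = x w" if "w \<in> W" for w using xW[OF that] y by (auto simp: \<tau>_def homeomorphism_def)
  have "continuous_on W \<tau>"
    unfolding \<tau>_def
  proof (rule continuous_on_compose2[of "x' ` U'" y])
    show "continuous_on (x' ` U') y" using y by (simp add: homeomorphism_def)
    show "continuous_on W x" using A(4) \<open>W \<subseteq> U\<close> continuous_on_subset by blast
  qed (use xW in auto)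
  then have cont: "isCont \<tau> u" using \<open>open W\<close> \<open>u \<in> W\<close> continuous_on_eq_continuous_at by blast
  have "\<tau> differentiable (at u)"
  proof (rule has_derivative_lift[where f = x' and h = x])
    show "(x' has_derivative frechet_derivative x' (at u')) (at (\<tau> u))"
      using smooth_on_differentiable[OF B(2) u(2)] by (simp add: \<tau>u frechet_derivative_works)
    show "(x has_derivative frechet_derivative x (at u)) (at u)"
      using smooth_on_differentiable[OF A(2) u(1)] by (simp add: frechet_derivative_works)
    show "inj (frechet_derivative x' (at u'))" by (rule B(6)[OF u(2)])
    show "\<forall>\<^sub>F w in at u. x' (\<tau> w) = x w"
      using x\<tau> \<open>open W\<close> \<open>u \<in> W\<close> eventually_at_topological by blast
  qed (use cont \<tau>u u in auto)
  then show thesis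
    using that \<open>open W\<close> \<open>u \<in> W\<close> \<open>W \<subseteq> U\<close> \<tau>u \<tau>W x\<tau> by blast
qed

lemma admissible_chartI:
  "admissible_surface M \<Longrightarrow> local_parametrization M U x \<Longrightarrow> admissible_chart U x"
  using local_parametrizationD unfolding admissible_surface_def admissible_chart_def by blast

text \<open>Near \<open>u\<close> the functions \<open>F\<close>, \<open>p\<close>, \<open>q\<close> of the first chart are those of the second chart composed with the
  transition map. Pulling the equation \<open>dF' = D 1 F' dp' + D 2 F' dq'\<close> back by it gives an
  expansion of \<open>dF\<close> in \<open>dp\<close> and \<open>dq\<close>, and this expansion is unique. The lemma can be iterated,
  because its conclusion provides the hypothesis \<open>agree\<close> for \<open>top_deriv x k F\<close>.\<close>

lemma top_deriv_chart_independent: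
  assumes adm: "admissible_surface M"
    and M: "local_parametrization M U x" and M': "local_parametrization M U' x'"
    and F: "smooth_on U F" and F': "smooth_on U' F'"
    and agree: "\<And>w w'. w \<in> U \<Longrightarrow> w' \<in> U' \<Longrightarrow> x w = x' w' \<Longrightarrow> F w = F' w'"
    and u: "u \<in> U" "u' \<in> U'" "x u = x' u'"
  shows "top_deriv x k F u = top_deriv x' k F' u'"
proof -
  interpret A: admissible_chart U x by (rule admissible_chartI[OF adm M])
  interpret B: admissible_chart U' x' by (rule admissible_chartI[OF adm M'])
  obtain \<tau> W where W: "open W" "u \<in> W" "W \<subseteq> U" "\<tau> u = u'" "\<tau> ` W \<subseteq> U'"
    "\<And>w. w \<in> W \<Longrightarrow> x' (\<tau> w) = x w" "\<tau> differentiable (at u)"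
    using differentiable_transition[OF M M' u] by blast
  obtain t where t: "(\<tau> has_derivative t) (at u)" using W(7) by (auto simp: differentiable_def)
  have chain: "pderiv_at i G u = t (axis i 1) $ 1 * pderiv_at 1 G' u' + t (axis i 1) $ 2 * pderiv_at 2 G' u'"
    if G': "smooth_on U' G'" and eq: "\<And>w. w \<in> W \<Longrightarrow> G w = G' (\<tau> w)" for G G' :: "real^2 \<Rightarrow> real" and i
  proof -
    have "(G' has_derivative (\<lambda>v. v $ 1 * pderiv_at 1 G' u' + v $ 2 * pderiv_at 2 G' u')) (at (\<tau> u))"
      using has_derivative_pderiv_at[OF smooth_on_differentiable[OF G' u(2)]] by (simp add: W(4))
    from has_derivative_compose[OF t this]
    have "pderiv_at i (\<lambda>w. G' (\<tau> w)) u = t (axis i 1) $ 1 * pderiv_at 1 G' u' + t (axis i 1) $ 2 * pderiv_at 2 G' u'"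
      by (rule pderiv_at_eq)
    moreover have "pderiv_at i G u = pderiv_at i (\<lambda>w. G' (\<tau> w)) u"
      using pderiv_at_cong[OF W(1,2) eq] .
    ultimately show ?thesis by simp
  qed
  have comp: "component x k w = component x' k (\<tau> w)" if "w \<in> W" for k w using W(6)[OF that] by simp
  have FF: "F w = F' (\<tau> w)" if "w \<in> W" for w
    using that agree[of w "\<tau> w"] W(3,5) W(6)[OF that] by auto
  have "pderiv_at i F u = B.D 1 F' u' * pderiv_at i (component x 1) u + B.D 2 F' u' * pderiv_at i (component x 2) u" for i
  proof -
    have "pderiv_at i F u = t (axis i 1) $ 1 * pderiv_at 1 F' u' + t (axis i 1) $ 2 * pderiv_at 2 F' u'"
      by (rule chain[OF F' FF])
    moreover have "pderiv_at i (component x k) u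
        = t (axis i 1) $ 1 * pderiv_at 1 (component x' k) u' + t (axis i 1) $ 2 * pderiv_at 2 (component x' k) u'" for k
      by (rule chain[OF B.smooth_component comp])
    ultimately show ?thesis
      using B.pderiv_via_top_deriv[OF u(2), of 1 F'] B.pderiv_via_top_deriv[OF u(2), of 2 F']
      by (simp add: algebra_simps)
  qed
  from A.top_deriv_unique[OF u(1) this] show ?thesis
    using exhaust_2[of k] by auto
qed

section \<open>From charts to the surface\<close>

lemma function_on_surface:
  assumes "\<And>U x u U' x' u'. local_parametrization M U x \<Longrightarrow> local_parametrization M U' x' \<Longrightarrow>
      u \<in> U \<Longrightarrow> u' \<in> U' \<Longrightarrow> x u = x' u' \<Longrightarrow> f x u = f x' u'"
  obtains h where "\<And>U x u. local_parametrization M U x \<Longrightarrow> u \<in> U \<Longrightarrow> h (x u) = f x u"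
proof
  fix U x u assume 1: "local_parametrization M U x" "u \<in> U"
  let ?P = "\<lambda>z. \<exists>U' x' u'. local_parametrization M U' x' \<and> u' \<in> U' \<and> x' u' = x u \<and> z = f x' u'"
  have "?P (SOME z. ?P z)" using 1 by (intro someI[of ?P "f x u"]) blast
  then obtain U' x' u' where "local_parametrization M U' x'" "u' \<in> U'" "x' u' = x u" "(SOME z. ?P z) = f x' u'"
    by blast
  then show "(\<lambda>y. SOME z. \<exists>U' x' u'. local_parametrization M U' x' \<and> u' \<in> U' \<and> x' u' = y \<and> z = f x' u') (x u) = f x u"
    using assms[OF _ 1(1) _ 1(2)] by simp
qed

text \<open>A chart maps small balls to relatively open subsets of \<open>M\<close>, and \<open>h\<close> is constant on these, so
  connectedness gives the claim. The hypothesis speaks of \<open>h\<close> through charts because \<open>M\<close> itself carries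
  no derivative.\<close>

lemma stationary_on_surface_imp_constant:
  fixes h :: "real^3 \<Rightarrow> real"
  assumes "connected M" "smooth_surface M"
    and stat: "\<And>U x u. local_parametrization M U x \<Longrightarrow> u \<in> U \<Longrightarrow> ((\<lambda>w. h (x w)) has_derivative (\<lambda>v. 0)) (at u)"
  shows "h constant_on M"
proof (rule locally_constant_imp_constant[OF assms(1)])
  fix a assume "a \<in> M"
  then obtain U x u where x: "local_parametrization M U x" "u \<in> U" "x u = a"
    using assms(2) by (auto simp: smooth_surface_def)
  obtain e where e: "e > 0" "ball u e \<subseteq> U"
    using local_parametrizationD(1)[OF x(1)] x(2) open_contains_ball by blast
  have "h (x w) = h (x u)" if "w \<in> ball u e" for w
  proof (rule has_derivative_zero_unique[of "ball u e" "\<lambda>w. h (x w)", OF convex_ball _ that])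
    show "((\<lambda>w. h (x w)) has_derivative (\<lambda>v. 0)) (at v within ball u e)" if "v \<in> ball u e" for v
      using stat[OF x(1)] that e(2) has_derivative_at_withinI by blast
    show "u \<in> ball u e" using e(1) by simp
  qed
  then show "\<exists>T. openin (top_of_set M) T \<and> a \<in> T \<and> (\<forall>y\<in>T. h y = h a)"
    using chart_image_openin[OF x(1) open_ball e(2)] e(1) x(3) by (intro exI[of _ "x ` ball u e"]) auto
qed

lemma slope_on_surface:
  assumes adm: "admissible_surface M"
  obtains h where "\<And>U x u. local_parametrization M U x \<Longrightarrow> u \<in> U \<Longrightarrow> h (x u) = top_deriv x k (component x 3) u"
proof (rule function_on_surface[of M "\<lambda>x. top_deriv x k (component x 3)"])
  show "top_deriv x k (component x 3) u = top_deriv x' k (component x' 3) u'"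
    if "local_parametrization M U x" "local_parametrization M U' x'" "u \<in> U" "u' \<in> U'" "x u = x' u'" for U x u U' x' u'
    using that admissible_chart.smooth_component[OF admissible_chartI[OF adm]]
    by (intro top_deriv_chart_independent[OF adm that(1,2)]) auto
qed blast

lemma iso_mean_curvature_chart_independent:
  assumes adm: "admissible_surface M"
    and M: "local_parametrization M U x" and M': "local_parametrization M U' x'"
    and u: "u \<in> U" "u' \<in> U'" "x u = x' u'"
  shows "iso_mean_curvature x u = iso_mean_curvature x' u'"
proof -
  interpret A: admissible_chart U x by (rule admissible_chartI[OF adm M])
  interpret B: admissible_chart U' x' by (rule admissible_chartI[OF adm M'])
  note step = top_deriv_chart_independent[OF adm M M']
  have slope: "A.D i A.r w = B.D i B.r w'" if "w \<in> U" "w' \<in> U'" "x w = x' w'" for i w w'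
    using that by (intro step smooth_intros A.smooth_component B.smooth_component) auto
  have "A.D j (A.D i A.r) u = B.D j (B.D i B.r) u'" for i j
    by (intro step slope A.smooth_top_deriv A.smooth_component B.smooth_top_deriv B.smooth_component u)
  then show ?thesis by (simp add: A.iso_mean_curvature_eq B.iso_mean_curvature_eq u)
qed

section \<open>The two characterizations\<close>

lemma minimal_normal_harmonic_iff:
  assumes "connected M" and adm: "admissible_surface M"
  shows "minimal_normal_harmonic M \<longleftrightarrow> constant_iso_mean_curvature M"
proof
  assume harm: "minimal_normal_harmonic M"
  obtain h where h: "\<And>U x u. local_parametrization M U x \<Longrightarrow> u \<in> U \<Longrightarrow> h (x u) = iso_mean_curvature x u"
    using function_on_surface[of M iso_mean_curvature] iso_mean_curvature_chart_independent[OF adm] by metis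
  have "h constant_on M"
  proof (rule stationary_on_surface_imp_constant[OF assms(1)])
    show "smooth_surface M" using adm by (simp add: admissible_surface_def)
    fix U x u assume M: "local_parametrization M U x" and "u \<in> U"
    interpret admissible_chart U x by (rule admissible_chartI[OF adm M])
    have "D k (iso_mean_curvature x) u = 0" for k
      using vector_laplace_minimal_normal[OF \<open>u \<in> U\<close>] harm M \<open>u \<in> U\<close> by (auto simp: minimal_normal_harmonic_def)
    then have "(iso_mean_curvature x has_derivative (\<lambda>v. 0)) (at u)"
      by (rule zero_top_deriv_imp_zero_derivative[OF \<open>u \<in> U\<close> smooth_iso_mean_curvature])
    then show "((\<lambda>w. h (x w)) has_derivative (\<lambda>v. 0)) (at u)"
      by (rule has_derivative_transform_within_open[OF _ open_U \<open>u \<in> U\<close>]) (simp add: h[OF M])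
  qed
  then obtain c where "\<And>y. y \<in> M \<Longrightarrow> h y = c" by (auto simp: constant_on_def)
  then show "constant_iso_mean_curvature M"
    unfolding constant_iso_mean_curvature_def using h local_parametrizationD(3) by (metis image_subset_iff)
next
  assume "constant_iso_mean_curvature M"
  then obtain c where c: "\<And>U x u. local_parametrization M U x \<Longrightarrow> u \<in> U \<Longrightarrow> iso_mean_curvature x u = c"
    by (auto simp: constant_iso_mean_curvature_def)
  show "minimal_normal_harmonic M"
    unfolding minimal_normal_harmonic_def
  proof (intro allI impI ballI)
    fix U x u assume M: "local_parametrization M U x" and "u \<in> U"
    interpret admissible_chart U x by (rule admissible_chartI[OF adm M])
    have "D k (iso_mean_curvature x) u = D k (\<lambda>w. c) u" for k
      by (intro top_deriv_cong \<open>u \<in> U\<close> c[OF M])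
    then show "vector_laplace_beltrami x (minimal_normal x) u = 0"
      using vector_laplace_minimal_normal[OF \<open>u \<in> U\<close>] by simp
  qed
qed

text \<open>A chart is an injective continuous map from an open subset of the plane into \<open>P\<close>, hence open into
  \<open>P\<close> by invariance of domain.\<close>

lemma surface_in_plane_openin:
  assumes "smooth_surface M" "M \<subseteq> P" "affine P" "aff_dim P = 2"
  shows "openin (top_of_set P) M"
proof (subst openin_subopen, intro ballI)
  fix a assume "a \<in> M"
  then obtain U x where x: "local_parametrization M U x" "a \<in> x ` U"
    using assms(1) by (auto simp: smooth_surface_def)
  note A = local_parametrizationD[OF x(1)]
  have "openin (top_of_set P) (x ` U)"
  proof (rule invariance_of_domain_affine_sets[of UNIV])
    show "x \<in> U \<rightarrow> P" using A(3) assms(2) by blast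
  qed (use A assms in auto)
  then show "\<exists>T. openin (top_of_set P) T \<and> a \<in> T \<and> T \<subseteq> M" using x(2) A(3) by blast
qed

text \<open>The slopes \<open>D 1 r\<close> and \<open>D 2 r\<close> are functions on \<open>M\<close> with zero derivative, hence constants \<open>a 1\<close>,
  \<open>a 2\<close>. Then \<open>n = (- a 1, - a 2, 1)\<close> is normal to \<open>M\<close> everywhere, so \<open>y \<mapsto> n \<bullet> y\<close> also has zero
  derivative along \<open>M\<close>, and its constant value determines the plane.\<close>

lemma parabolic_harmonic_imp_plane:
  assumes "connected M" and adm: "admissible_surface M" and harm: "parabolic_normal_harmonic M"
  shows "piece_of_plane M"
proof (cases "M = {}")
  case True
  \<comment> \<open>The empty surface is an open piece of every plane; one has to be exhibited.\<close>
  have "aff_dim {y::real^3. axis 1 1 \<bullet> y = 0} = 2"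
    by (subst aff_dim_hyperplane) (auto simp: axis_eq_0_iff)
  then show ?thesis
    unfolding piece_of_plane_def True using affine_hyperplane openin_empty by blast
next
  case False
  have surf: "smooth_surface M" using adm by (simp add: admissible_surface_def)
  have "\<exists>a. \<forall>U x u. local_parametrization M U x \<longrightarrow> u \<in> U \<longrightarrow> top_deriv x k (component x 3) u = a" for k
  proof -
    obtain h where h: "\<And>U x u. local_parametrization M U x \<Longrightarrow> u \<in> U \<Longrightarrow> h (x u) = top_deriv x k (component x 3) u"
      using slope_on_surface[OF adm] by metis
    have "h constant_on M"
    proof (rule stationary_on_surface_imp_constant[OF assms(1) surf])
      fix U x u assume M: "local_parametrization M U x" and "u \<in> U"
      interpret admissible_chart U x by (rule admissible_chartI[OF adm M])
      have "D i (D k r) u = 0" for i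
        using parabolic_harmonic_imp_flat[OF _ \<open>u \<in> U\<close>] harm M \<open>u \<in> U\<close> by (auto simp: parabolic_normal_harmonic_def)
      then have "(D k r has_derivative (\<lambda>v. 0)) (at u)"
        by (rule zero_top_deriv_imp_zero_derivative[OF \<open>u \<in> U\<close> smooth_top_deriv[OF smooth_component]])
      then show "((\<lambda>w. h (x w)) has_derivative (\<lambda>v. 0)) (at u)"
        by (rule has_derivative_transform_within_open[OF _ open_U \<open>u \<in> U\<close>]) (simp add: h[OF M])
    qed
    then show ?thesis
      unfolding constant_on_def using h local_parametrizationD(3) by (metis image_subset_iff)
  qed
  then obtain a where a: "\<And>k U x u. local_parametrization M U x \<Longrightarrow> u \<in> U \<Longrightarrow> top_deriv x k (component x 3) u = a k"
    by metis
  define n :: "real^3" where "n = vector [- a 1, - a 2, 1]"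
  have "n \<noteq> 0" by (auto simp: n_def vec_eq_iff forall_3)
  have n: "n \<bullet> y = y $ 3 - a 1 * y $ 1 - a 2 * y $ 2" for y
    by (simp add: n_def inner_vec_def sum_3)
  have "(\<lambda>y. n \<bullet> y) constant_on M"
  proof (rule stationary_on_surface_imp_constant[OF assms(1) surf])
    fix U x u assume M: "local_parametrization M U x" and "u \<in> U"
    interpret admissible_chart U x by (rule admissible_chartI[OF adm M])
    have d: "component x k differentiable (at u)" for k
      using smooth_on_differentiable[OF smooth_component \<open>u \<in> U\<close>] .
    have "((\<lambda>w. n \<bullet> x w) has_derivative (\<lambda>v. 0)) (at u)"
    proof (rule has_derivative_zeroI)
      show "(\<lambda>w. n \<bullet> x w) differentiable (at u)"
        unfolding n by (intro derivative_intros d)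
      fix i
      have "pderiv_at i (\<lambda>w. n \<bullet> x w) u = pderiv_at i r u - a 1 * pderiv_at i p u - a 2 * pderiv_at i q u"
        unfolding n by (simp add: pderiv_at_diff pderiv_at_mult d)
      then show "pderiv_at i (\<lambda>w. n \<bullet> x w) u = 0"
        using pderiv_via_top_deriv[OF \<open>u \<in> U\<close>, of i r] a[OF M \<open>u \<in> U\<close>] by simp
    qed
    then show "((\<lambda>w. n \<bullet> x w) has_derivative (\<lambda>v. 0)) (at u)" .
  qed
  then obtain c where c: "M \<subseteq> {y. n \<bullet> y = c}" by (auto simp: constant_on_def)
  have "aff_dim {y. n \<bullet> y = c} = 2" using aff_dim_hyperplane[OF \<open>n \<noteq> 0\<close>] by simp
  then show ?thesis
    unfolding piece_of_plane_def using surface_in_plane_openin[OF surf c] affine_hyperplane by blast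
qed

text \<open>Admissibility excludes vertical planes: differentiating \<open>n \<bullet> x = d\<close> with \<open>n $ 3 = 0\<close> would make
  \<open>dp\<close> and \<open>dq\<close> linearly dependent. Solving for \<open>dr\<close> then shows that the slopes, and with them the
  parabolic normal, are constant.\<close>

lemma plane_imp_parabolic_harmonic:
  assumes adm: "admissible_surface M" and "piece_of_plane M"
  shows "parabolic_normal_harmonic M"
  unfolding parabolic_normal_harmonic_def
proof (intro allI impI ballI)
  fix U x u assume M: "local_parametrization M U x" and "u \<in> U"
  interpret admissible_chart U x by (rule admissible_chartI[OF adm M])
  obtain P where P: "affine P" "aff_dim P = 2" "M \<subseteq> P"
    using assms(2) openin_imp_subset unfolding piece_of_plane_def by blast
  have "aff_dim P = DIM(real^3) - 1" using P(2) by simp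
  then obtain n d where n: "n \<noteq> 0" "affine hull P = {y. n \<bullet> y = d}"
    using aff_dim_eq_hyperplane[of P] by auto
  have nx: "n $ 1 * p w + n $ 2 * q w + n $ 3 * r w = d" if "w \<in> U" for w
  proof -
    have "x w \<in> P" using that local_parametrizationD(3)[OF M] P(3) by auto
    then have "x w \<in> affine hull P" by (rule hull_inc)
    then show ?thesis by (simp add: n(2) inner_vec_def sum_3)
  qed
  have tangent: "n $ 1 * pderiv_at i p w + n $ 2 * pderiv_at i q w + n $ 3 * pderiv_at i r w = 0" if "w \<in> U" for w i
  proof -
    have dif: "component x k differentiable (at w)" for k
      using smooth_on_differentiable[OF smooth_component that] .
    have "pderiv_at i (\<lambda>w. n $ 1 * p w + n $ 2 * q w + n $ 3 * r w) w = pderiv_at i (\<lambda>w. d) w"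
      by (rule pderiv_at_cong[OF open_U that nx])
    then show ?thesis by (simp add: pderiv_at_add pderiv_at_mult dif)
  qed
  have "n $ 3 \<noteq> 0"
  proof
    assume "n $ 3 = 0"
    then have "n $ 1 * J u = 0" "n $ 2 * J u = 0"
      using tangent[OF \<open>u \<in> U\<close>, of 1] tangent[OF \<open>u \<in> U\<close>, of 2] unfolding top_jacobian_def by simp_all algebra+
    then show False using jacobian_nonzero[OF \<open>u \<in> U\<close>] \<open>n $ 3 = 0\<close> n(1) by (auto simp: vec_eq_iff forall_3)
  qed
  then have "pderiv_at i r w = (- n $ 1 / n $ 3) * pderiv_at i p w + (- n $ 2 / n $ 3) * pderiv_at i q w" if "w \<in> U" for w i
    using tangent[OF that, of i] by (simp add: field_simps)
  note slopes = top_deriv_unique[OF _ this]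
  show "vector_laplace_beltrami x (parabolic_normal x) u = 0"
  proof (rule constant_slopes_imp_parabolic_harmonic[OF _ \<open>u \<in> U\<close>])
    show "D k r w = (if k = 1 then - n $ 1 / n $ 3 else - n $ 2 / n $ 3)" if "w \<in> U" for w k
      using slopes[OF that that] exhaust_2[of k] by auto
  qed
qed

theorem theorem6p1:
  fixes M :: "(real^3) set"
  assumes "connected M" and "admissible_surface M"
  shows "(minimal_normal_harmonic M \<longleftrightarrow> constant_iso_mean_curvature M) \<and>
         (parabolic_normal_harmonic M \<longleftrightarrow> piece_of_plane M)"
  using minimal_normal_harmonic_iff[OF assms] parabolic_harmonic_imp_plane[OF assms]
    plane_imp_parabolic_harmonic[OF assms(2)] by blast

end
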